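(* Let $L_2$ be the lamplighter group with the word metric $d$ for the generating set $\{t,at\}$. Sending the asymptotic class $[\gamma]$ of a geodesic ray $\gamma$ based at the identity to its Busemann function $\mathfrak b^\gamma(x)=\lim_{n\to\infty}\big(d(\gamma(n),x)-d(\gamma(n),id)\big)$ gives a well-defined map $\partial_\infty L_2\to\partial_h L_2$. This map is injective but not continuous. However, its restriction to $\partial_\infty L_2^+$ (with the subspace topology) is continuous, and its restriction to $\partial_\infty L_2^-$ (with the subspace topology) is continuous.
   Context: Lamplighter group: $L_2=\langle a,t\mid a^2,\ [a^{t^i},a^{t^j}]\ \forall i,j\in\mathbb Z\rangle\cong(\bigoplus_{\mathbb Z}\mathbb Z/2)\rtimes\mathbb Z$. Each element is identified with a lamp stand: a finite set of lit lamps (positions in $\mathbb Z$) together with an integer position of the lamplighter. The identity $id$ has no lit lamps and lamplighter at $0$; right multiplication by $a$ toggles the lamp at the lamplighter's position; right multiplication by $t$ moves the lamplighter by $+1$. $H(g)\in\mathbb Z$ is the lamplighter's position in $g$. $d$ is the word metric on $L_2$ with respect to $S=\{t,at\}$, i.e. $d(g,h)$ is the length of $g^{-1}h$ in $S\cup S^{-1}$. Horofunction boundary: let $C(L_2)$ be the space of functions $L_2\to\mathbb R$ with the topology of uniform convergence on compact (i.e. finite) sets. Embed $i:L_2\to C(L_2)$ by $i(z)(x)=d(z,x)-d(z,id)$, let $\overline{L_2}$ be the closure of $i(L_2)$, and $\partial_h L_2=\overline{L_2}\setminus i(L_2)$. Visual boundary: a geodesic ray is an isometric embedding $\gamma:\mathbb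 N\to (L_2,d)$; it is based at the identity if $\gamma(0)=id$. Two rays $\gamma,\gamma'$ are asymptotic if $\sup_n d(\gamma(n),\gamma'(n))<\infty$. $\partial_\infty L_2$ is the set of asymptotic classes of geodesic rays based at $id$, with the quotient of the topology of uniform convergence on compact sets on the space of such rays. $\partial_\infty L_2^{+}$ (resp. $\partial_\infty L_2^-$) is the subset of classes of rays with $H(\gamma(n))\to+\infty$ (resp. $-\infty$); $\partial_\infty L_2$ is the disjoint union of these two subsets. *)

theory Defs
  imports "HOL-Analysis.Analysis" "HOL-Algebra.Group" "HOL-Library.FSet"
begin

section \<open>Word metrics\<close>

definition word_length :: "('a, 'b) monoid_scheme \<Rightarrow> 'a set \<Rightarrow> 'a \<Rightarrow> nat" where
  "word_length G S g =
     (LEAST n. \<exists>ws. length ws = n \<and> set ws \<subseteq> S \<union> m_inv G ` S \<and> foldr (mult G) ws (one G) = g)"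

definition word_dist :: "('a, 'b) monoid_scheme \<Rightarrow> 'a set \<Rightarrow> 'a \<Rightarrow> 'a \<Rightarrow> real" where
  "word_dist G S g h = real (word_length G S (inv\<^bsub>G\<^esub> g \<otimes>\<^bsub>G\<^esub> h))"


section \<open>The lamplighter group\<close>

text \<open>The group is realised on lamp stands, as the semidirect product
  of the finitely supported functions from the integers to the two-element group by the integers
  acting by translation. The accessor \<open>height\<close> is the function usually written \<open>H\<close>.\<close>

datatype lampstand = Lampstand (lit: "int fset") (height: int)

definition lamp_mult :: "lampstand \<Rightarrow> lampstand \<Rightarrow> lampstand" where
  "lamp_mult g h =
     (let B = (\<lambda>i. i + height g) |`| lit h
      in Lampstand ((lit g |-| B) |\<union>| (B |-| lit g)) (height g + height h))"

definition L2 :: "lampstand monoid" where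
  "L2 = \<lparr>carrier = UNIV, mult = lamp_mult, one = Lampstand {||} 0\<rparr>"

definition gen_a :: lampstand where "gen_a = Lampstand {|0|} 0"

definition gen_t :: lampstand where "gen_t = Lampstand {||} 1"

definition gens :: "lampstand set" where
  "gens = {gen_t, gen_a \<otimes>\<^bsub>L2\<^esub> gen_t}"

definition d2 :: "lampstand \<Rightarrow> lampstand \<Rightarrow> real" where
  "d2 = word_dist L2 gens"

lemma L2_simps [simp]:
  "carrier L2 = UNIV" "mult L2 = lamp_mult" "one L2 = Lampstand {||} 0"
  by (simp_all add: L2_def)

lemma height_lamp_mult [simp]: "height (lamp_mult g h) = height g + height h"
  by (simp add: lamp_mult_def Let_def)

lemma in_lit_lamp_mult [simp]:
  "i |\<in>| lit (lamp_mult g h) \<longleftrightarrow> (i |\<in>| lit g) \<noteq> (i - height g |\<in>| lit h)"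
proof -
  have "i |\<in>| (\<lambda>i. i + height g) |`| lit h \<longleftrightarrow> i - height g |\<in>| lit h"
    by (auto simp: image_iff intro!: bexI [of _ "i - height g"])
  then show ?thesis
    by (auto simp: lamp_mult_def Let_def)
qed

lemma lampstand_eqI:
  "(\<And>i. i |\<in>| lit g \<longleftrightarrow> i |\<in>| lit h) \<Longrightarrow> height g = height h \<Longrightarrow> g = h"
  by (cases g; cases h) (auto simp: fset_eq_iff)

lemma mult_gen_t: "g \<otimes>\<^bsub>L2\<^esub> gen_t = Lampstand (lit g) (height g + 1)"
  by (rule lampstand_eqI) (auto simp: gen_t_def)

lemma mult_gen_a:
  "g \<otimes>\<^bsub>L2\<^esub> gen_a =
     Lampstand (if height g |\<in>| lit g then lit g |-| {|height g|} else finsert (height g) (lit g))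
       (height g)"
  by (rule lampstand_eqI) (auto simp: gen_a_def)

lemma group_L2: "group L2"
proof (rule groupI)
  fix g :: lampstand
  let ?h = "Lampstand ((\<lambda>i. i - height g) |`| lit g) (- height g)"
  have "i + height g |\<in>| lit g" if "i |\<in>| (\<lambda>i. i - height g) |`| lit g" for i
    using that by auto
  moreover have "i |\<in>| (\<lambda>i. i - height g) |`| lit g" if "i + height g |\<in>| lit g" for i
    using that by (auto simp: image_iff intro!: bexI [of _ "i + height g"])
  ultimately have "lamp_mult ?h g = Lampstand {||} 0"
    by (intro lampstand_eqI) auto
  then show "\<exists>h\<in>carrier L2. h \<otimes>\<^bsub>L2\<^esub> g = \<one>\<^bsub>L2\<^esub>"
    by auto
qed (auto intro!: lampstand_eqI simp: algebra_simps)

lemma gens_generate: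
  "\<exists>ws. set ws \<subseteq> gens \<union> m_inv L2 ` gens \<and> foldr (mult L2) ws (one L2) = g"
proof -
  interpret group L2 by (rule group_L2)
  define T where "T = gens \<union> m_inv L2 ` gens"
  define P where "P g \<longleftrightarrow> (\<exists>ws. set ws \<subseteq> T \<and> foldr (mult L2) ws (one L2) = g)" for g
  have foldr_append: "foldr (mult L2) us x = mult L2 (foldr (mult L2) us (one L2)) x" for us x
    by (induction us) (simp_all add: m_assoc [simplified] l_one [simplified])
  have step: "P (g \<otimes>\<^bsub>L2\<^esub> s)" if "P g" "s \<in> T" for g s
  proof -
    obtain ws where "set ws \<subseteq> T" "foldr (mult L2) ws (one L2) = g"
      using \<open>P g\<close> by (auto simp: P_def)
    moreover have "foldr (mult L2) (ws @ [s]) (one L2) = foldr (mult L2) ws (one L2) \<otimes>\<^bsub>L2\<^esub> s"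
      using foldr_append [of ws s] r_one [of s] by simp
    ultimately show ?thesis
      unfolding P_def using \<open>s \<in> T\<close> by (intro exI [of _ "ws @ [s]"]) simp
  qed
  have T: "gen_t \<in> T" "inv\<^bsub>L2\<^esub> gen_t \<in> T" "gen_a \<otimes>\<^bsub>L2\<^esub> gen_t \<in> T"
    unfolding T_def gens_def by blast+
  have inv_t: "inv\<^bsub>L2\<^esub> gen_t = Lampstand {||} (-1)"
    by (rule inv_equality) (auto simp: gen_t_def intro: lampstand_eqI)
  have mult_inv_t: "g \<otimes>\<^bsub>L2\<^esub> inv\<^bsub>L2\<^esub> gen_t = Lampstand (lit g) (height g - 1)" for g
    unfolding inv_t by (rule lampstand_eqI) auto
  have toggle: "P (g \<otimes>\<^bsub>L2\<^esub> gen_a)" if "P g" for g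
  proof -
    have "P (g \<otimes>\<^bsub>L2\<^esub> (gen_a \<otimes>\<^bsub>L2\<^esub> gen_t) \<otimes>\<^bsub>L2\<^esub> inv\<^bsub>L2\<^esub> gen_t)"
      by (intro step that T)
    also have "g \<otimes>\<^bsub>L2\<^esub> (gen_a \<otimes>\<^bsub>L2\<^esub> gen_t) \<otimes>\<^bsub>L2\<^esub> inv\<^bsub>L2\<^esub> gen_t = g \<otimes>\<^bsub>L2\<^esub> gen_a"
      unfolding inv_t by (rule lampstand_eqI) (auto simp: gen_t_def)
    finally show ?thesis .
  qed
  have move: "P (Lampstand A k)" if "P (Lampstand A m)" for A k m
  proof (induction k rule: int_induct [of _ m])
    case base
    show ?case by (fact that)
  next
    case (step1 i)
    then show ?case using step [OF step1(2) T(1)] by (simp add: mult_gen_t del: L2_simps)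
  next
    case (step2 i)
    then show ?case using step [OF step2(2) T(2)] by (simp add: mult_inv_t del: L2_simps)
  qed
  have "P (Lampstand A k)" for A k
  proof (induction A arbitrary: k)
    case empty
    have "P (Lampstand {||} 0)"
      unfolding P_def by (rule exI [of _ "[]"]) simp
    then show ?case by (rule move)
  next
    case (insert x A)
    have "P (Lampstand (finsert x A) x)"
      using toggle [OF insert.IH [of x]] insert.hyps by (simp add: mult_gen_a del: L2_simps)
    then show ?case by (rule move)
  qed
  then show ?thesis
    by (cases g) (simp add: P_def T_def)
qed

lemma Metric_space_d2: "Metric_space UNIV d2"
proof -
  interpret group L2 by (rule group_L2)
  define T where "T = gens \<union> m_inv L2 ` gens"
  define V where "V ws = foldr (mult L2) ws (one L2)" for ws
  define l where "l = word_length L2 gens"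
  have inv_T: "inv\<^bsub>L2\<^esub> s \<in> T" if "s \<in> T" for s
    using that inv_inv by (auto simp: T_def)
  have V_Nil: "V [] = one L2" and V_Cons: "V (w # ws) = w \<otimes>\<^bsub>L2\<^esub> V ws" for w ws
    by (simp_all add: V_def)
  have V_append: "V (us @ vs) = V us \<otimes>\<^bsub>L2\<^esub> V vs" for us vs
  proof (induction us)
    case Nil
    show ?case using l_one [of "V vs"] by (simp add: V_Nil)
  next
    case (Cons u us)
    then show ?case using m_assoc [of u "V us" "V vs"] by (simp add: V_Cons)
  qed
  have V_inv: "V (rev (map (m_inv L2) ws)) = inv\<^bsub>L2\<^esub> V ws" for ws
  proof (induction ws)
    case Nil
    show ?case using inv_one by (simp add: V_Nil)
  next
    case (Cons w ws)
    then show ?case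
      using inv_mult_group [of w "V ws"] r_one [of "inv\<^bsub>L2\<^esub> w"]
      by (simp add: V_Cons V_Nil V_append)
  qed
  have l_eq: "l g = (LEAST n. \<exists>ws. length ws = n \<and> set ws \<subseteq> T \<and> V ws = g)" for g
    by (simp add: l_def word_length_def T_def V_def)
  have l_le: "l (V ws) \<le> length ws" if "set ws \<subseteq> T" for ws
    unfolding l_eq by (rule Least_le) (use that in blast)
  have l_ex: "\<exists>ws. length ws = l g \<and> set ws \<subseteq> T \<and> V ws = g" for g
    unfolding l_eq by (rule LeastI_ex) (use gens_generate [of g] in \<open>auto simp: T_def V_def\<close>)
  have l_inv_le: "l (inv\<^bsub>L2\<^esub> g) \<le> l g" for g
  proof -
    obtain ws where ws: "length ws = l g" "set ws \<subseteq> T" "V ws = g"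
      using l_ex by blast
    then have "set (rev (map (m_inv L2) ws)) \<subseteq> T" using inv_T by auto
    from l_le [OF this] show ?thesis using ws by (simp add: V_inv)
  qed
  have l_mult: "l (g \<otimes>\<^bsub>L2\<^esub> h) \<le> l g + l h" for g h
  proof -
    obtain us vs where "length us = l g" "set us \<subseteq> T" "V us = g"
      "length vs = l h" "set vs \<subseteq> T" "V vs = h"
      using l_ex by metis
    then show ?thesis using l_le [of "us @ vs"] by (simp add: V_append)
  qed
  have l_zero: "l g = 0 \<longleftrightarrow> g = one L2" for g
    using l_ex [of g] l_le [of "[]"] by (auto simp: V_Nil)
  have l_sym: "l (inv\<^bsub>L2\<^esub> g \<otimes>\<^bsub>L2\<^esub> h) \<le> l (inv\<^bsub>L2\<^esub> h \<otimes>\<^bsub>L2\<^esub> g)" for g h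
  proof -
    have "inv\<^bsub>L2\<^esub> (inv\<^bsub>L2\<^esub> h \<otimes>\<^bsub>L2\<^esub> g) = inv\<^bsub>L2\<^esub> g \<otimes>\<^bsub>L2\<^esub> h"
      using inv_mult_group [of "inv\<^bsub>L2\<^esub> h" g] inv_inv [of h] by simp
    then show ?thesis using l_inv_le [of "inv\<^bsub>L2\<^esub> h \<otimes>\<^bsub>L2\<^esub> g"] by simp
  qed
  have d2_eq: "d2 g h = real (l (inv\<^bsub>L2\<^esub> g \<otimes>\<^bsub>L2\<^esub> h))" for g h
    by (simp add: d2_def word_dist_def l_def)
  show ?thesis
  proof
    fix g h k :: lampstand
    show "0 \<le> d2 g h" by (simp add: d2_eq)
    show "d2 g h = d2 h g" using l_sym [of g h] l_sym [of h g] by (simp add: d2_eq)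
    have "inv\<^bsub>L2\<^esub> g \<otimes>\<^bsub>L2\<^esub> h = one L2 \<longleftrightarrow> g = h"
      using m_assoc [of g "inv\<^bsub>L2\<^esub> g" h] r_inv [of g] l_inv [of g] l_one [of h] r_one [of g]
      by (auto simp del: L2_simps(2,3))
    then show "d2 g h = 0 \<longleftrightarrow> g = h" using l_zero by (simp add: d2_eq del: L2_simps)
    have "(inv\<^bsub>L2\<^esub> g \<otimes>\<^bsub>L2\<^esub> h) \<otimes>\<^bsub>L2\<^esub> (inv\<^bsub>L2\<^esub> h \<otimes>\<^bsub>L2\<^esub> k) = inv\<^bsub>L2\<^esub> g \<otimes>\<^bsub>L2\<^esub> k"
      using inv_solve_left [of "inv\<^bsub>L2\<^esub> h \<otimes>\<^bsub>L2\<^esub> k" h k] m_assoc [of "inv\<^bsub>L2\<^esub> g" h "inv\<^bsub>L2\<^esub> h \<otimes>\<^bsub>L2\<^esub> k"]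
      by simp
    then show "d2 g k \<le> d2 g h + d2 h k"
      using l_mult [of "inv\<^bsub>L2\<^esub> g \<otimes>\<^bsub>L2\<^esub> h" "inv\<^bsub>L2\<^esub> h \<otimes>\<^bsub>L2\<^esub> k"] by (simp add: d2_eq)
  qed
qed


section \<open>Uniform convergence on compact sets\<close>

text \<open>All domains considered here are discrete, so that the compact subsets are the finite ones.
  The codomain carries the distance \<open>\<delta>\<close>.\<close>

definition ucc_topology :: "('b \<Rightarrow> 'b \<Rightarrow> real) \<Rightarrow> ('a \<Rightarrow> 'b) topology" where
  "ucc_topology \<delta> = topology (\<lambda>U. \<forall>f\<in>U. \<exists>K \<epsilon>. finite K \<and> \<epsilon> > 0 \<and>
      {g. \<forall>x\<in>K. \<delta> (f x) (g x) < \<epsilon>} \<subseteq> U)"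

lemma openin_ucc_topology:
  "openin (ucc_topology \<delta>) U \<longleftrightarrow>
     (\<forall>f\<in>U. \<exists>K \<epsilon>. finite K \<and> \<epsilon> > 0 \<and> {g. \<forall>x\<in>K. \<delta> (f x) (g x) < \<epsilon>} \<subseteq> U)"
proof -
  have "istopology (\<lambda>U. \<forall>f\<in>U. \<exists>K \<epsilon>. finite K \<and> \<epsilon> > 0 \<and> {g. \<forall>x\<in>K. \<delta> (f x) (g x) < \<epsilon>} \<subseteq> U)"
    (is "istopology ?open")
    unfolding istopology_def
  proof (intro conjI allI impI ballI)
    fix U V f
    assume "?open U" "?open V" "f \<in> U \<inter> V"
    then obtain K \<epsilon> L \<eta> where
      "finite K" "\<epsilon> > 0" "{g. \<forall>x\<in>K. \<delta> (f x) (g x) < \<epsilon>} \<subseteq> U"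
      "finite L" "\<eta> > 0" "{g. \<forall>x\<in>L. \<delta> (f x) (g x) < \<eta>} \<subseteq> V"
      by (meson IntD1 IntD2)
    then show "\<exists>K \<epsilon>. finite K \<and> \<epsilon> > 0 \<and> {g. \<forall>x\<in>K. \<delta> (f x) (g x) < \<epsilon>} \<subseteq> U \<inter> V"
      by (intro exI [of _ "K \<union> L"] exI [of _ "min \<epsilon> \<eta>"]) auto
  next
    fix \<K> f
    assume "\<forall>U\<in>\<K>. ?open U" "f \<in> \<Union>\<K>"
    then show "\<exists>K \<epsilon>. finite K \<and> \<epsilon> > 0 \<and> {g. \<forall>x\<in>K. \<delta> (f x) (g x) < \<epsilon>} \<subseteq> \<Union>\<K>"
      by (meson UnionE Union_upper subset_trans)
  qed
  then show ?thesis
    unfolding ucc_topology_def by (subst topology_inverse') (assumption, rule refl)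
qed

lemma topspace_ucc_topology [simp]: "topspace (ucc_topology \<delta>) = UNIV"
proof -
  have "openin (ucc_topology \<delta>) UNIV"
    by (auto simp: openin_ucc_topology intro!: exI [of _ "{}"] exI [of _ 1])
  then show ?thesis
    using openin_subset by blast
qed


section \<open>The horofunction boundary\<close>

definition horo_embedding :: "lampstand \<Rightarrow> lampstand \<Rightarrow> real" where
  "horo_embedding z x = d2 z x - d2 z \<one>\<^bsub>L2\<^esub>"

definition horofunction_boundary :: "(lampstand \<Rightarrow> real) set" where
  "horofunction_boundary =
     (ucc_topology dist closure_of range horo_embedding) - range horo_embedding"

definition horofunction_topology :: "(lampstand \<Rightarrow> real) topology" where
  "horofunction_topology = subtopology (ucc_topology dist) horofunction_boundary"

lemma topspace_horofunction_topology [simp]: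
  "topspace horofunction_topology = horofunction_boundary"
  by (simp add: horofunction_topology_def)


section \<open>The visual boundary\<close>

definition based_rays :: "(nat \<Rightarrow> lampstand) set" where
  "based_rays = {\<gamma>. \<gamma> 0 = \<one>\<^bsub>L2\<^esub> \<and> (\<forall>m n. d2 (\<gamma> m) (\<gamma> n) = \<bar>real m - real n\<bar>)}"

definition asymptotic :: "((nat \<Rightarrow> lampstand) \<times> (nat \<Rightarrow> lampstand)) set" where
  "asymptotic = {(\<gamma>, \<gamma>'). \<gamma> \<in> based_rays \<and> \<gamma>' \<in> based_rays \<and>
     bdd_above (range (\<lambda>n. d2 (\<gamma> n) (\<gamma>' n)))}"

lemma equiv_asymptotic: "equiv based_rays asymptotic"
proof -
  interpret Metric_space UNIV d2 by (rule Metric_space_d2)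
  have "sym asymptotic" by (auto simp: sym_def asymptotic_def commute)
  moreover have "trans asymptotic"
  proof (rule transI)
    fix \<gamma>\<^sub>1 \<gamma>\<^sub>2 \<gamma>\<^sub>3
    assume *: "(\<gamma>\<^sub>1, \<gamma>\<^sub>2) \<in> asymptotic" "(\<gamma>\<^sub>2, \<gamma>\<^sub>3) \<in> asymptotic"
    then obtain A B where "\<And>n. d2 (\<gamma>\<^sub>1 n) (\<gamma>\<^sub>2 n) \<le> A" "\<And>n. d2 (\<gamma>\<^sub>2 n) (\<gamma>\<^sub>3 n) \<le> B"
      by (auto simp: asymptotic_def bdd_above_def)
    then have "d2 (\<gamma>\<^sub>1 n) (\<gamma>\<^sub>3 n) \<le> A + B" for n
      using triangle [of "\<gamma>\<^sub>1 n" "\<gamma>\<^sub>2 n" "\<gamma>\<^sub>3 n"] by (meson UNIV_I add_mono order_trans)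
    then show "(\<gamma>\<^sub>1, \<gamma>\<^sub>3) \<in> asymptotic"
      using * by (auto simp: asymptotic_def bdd_above_def)
  qed
  ultimately show ?thesis
    by (auto simp: equiv_def refl_on_def asymptotic_def)
qed

definition visual_boundary :: "(nat \<Rightarrow> lampstand) set set" where
  "visual_boundary = based_rays // asymptotic"

definition ray_topology :: "(nat \<Rightarrow> lampstand) topology" where
  "ray_topology = subtopology (ucc_topology d2) based_rays"

definition visual_topology :: "(nat \<Rightarrow> lampstand) set topology" where
  "visual_topology = topology (\<lambda>U. U \<subseteq> visual_boundary \<and>
      openin ray_topology {\<gamma> \<in> based_rays. asymptotic `` {\<gamma>} \<in> U})"

definition visual_boundary_plus :: "(nat \<Rightarrow> lampstand) set set" where
  "visual_boundary_plus =
     {asymptotic `` {\<gamma>} | \<gamma>. \<gamma> \<in> based_rays \<and> filterlim (\<lambda>n. height (\<gamma> n)) at_top sequentially}"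

definition visual_boundary_minus :: "(nat \<Rightarrow> lampstand) set set" where
  "visual_boundary_minus =
     {asymptotic `` {\<gamma>} | \<gamma>. \<gamma> \<in> based_rays \<and> filterlim (\<lambda>n. height (\<gamma> n)) at_bot sequentially}"

lemma topspace_ray_topology [simp]: "topspace ray_topology = based_rays"
  by (simp add: ray_topology_def)

lemma openin_visual_topology:
  "openin visual_topology U \<longleftrightarrow>
     U \<subseteq> visual_boundary \<and> openin ray_topology {\<gamma> \<in> based_rays. asymptotic `` {\<gamma>} \<in> U}"
proof -
  have "istopology (\<lambda>U. U \<subseteq> visual_boundary \<and>
      openin ray_topology {\<gamma> \<in> based_rays. asymptotic `` {\<gamma>} \<in> U})"
    unfolding istopology_def
  proof (intro conjI allI impI; (elim conjE)?)
    fix U V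
    assume "openin ray_topology {\<gamma> \<in> based_rays. asymptotic `` {\<gamma>} \<in> U}"
      "openin ray_topology {\<gamma> \<in> based_rays. asymptotic `` {\<gamma>} \<in> V}"
    then have "openin ray_topology ({\<gamma> \<in> based_rays. asymptotic `` {\<gamma>} \<in> U} \<inter>
        {\<gamma> \<in> based_rays. asymptotic `` {\<gamma>} \<in> V})"
      by (rule openin_Int)
    also have "\<dots> = {\<gamma> \<in> based_rays. asymptotic `` {\<gamma>} \<in> U \<inter> V}" by auto
    finally show "openin ray_topology {\<gamma> \<in> based_rays. asymptotic `` {\<gamma>} \<in> U \<inter> V}" .
  next
    fix \<K>
    assume *: "\<forall>U\<in>\<K>. U \<subseteq> visual_boundary \<and>
        openin ray_topology {\<gamma> \<in> based_rays. asymptotic `` {\<gamma>} \<in> U}"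
    have "{\<gamma> \<in> based_rays. asymptotic `` {\<gamma>} \<in> \<Union>\<K>} =
        (\<Union>U\<in>\<K>. {\<gamma> \<in> based_rays. asymptotic `` {\<gamma>} \<in> U})" by auto
    then show "openin ray_topology {\<gamma> \<in> based_rays. asymptotic `` {\<gamma>} \<in> \<Union>\<K>}"
      using * by (auto simp only: intro!: openin_Union)
  qed auto
  then show ?thesis
    by (simp add: visual_topology_def topology_inverse')
qed

lemma topspace_visual_topology [simp]: "topspace visual_topology = visual_boundary"
proof -
  have "{\<gamma> \<in> based_rays. asymptotic `` {\<gamma>} \<in> visual_boundary} = topspace ray_topology"
    by (auto simp: visual_boundary_def quotientI)
  then have "openin visual_topology visual_boundary"
    by (simp add: openin_visual_topology del: topspace_ray_topology)
  then show ?thesis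
    by (meson openin_subset openin_topspace openin_visual_topology subset_antisym)
qed

lemma quotient_map_visual_topology:
  "quotient_map ray_topology visual_topology (\<lambda>\<gamma>. asymptotic `` {\<gamma>})"
  unfolding quotient_map_def
  by (auto simp: openin_visual_topology visual_boundary_def quotient_def)

end

theory Submission
  imports Defs
begin

text \<open>
  Since both generators move the lamplighter, lamp \<open>i\<close> can be toggled exactly when the edge from
  \<open>i\<close> to \<open>i + 1\<close> is crossed. Hence \<open>d(g, h) = 2(hi - lo) - \<bar>H g - H h\<bar>\<close>, where \<open>[lo, hi]\<close> is the
  smallest interval containing both positions and all edges at which the lamps differ. It follows
  that a geodesic ray from the identity turns at most once, at height \<open>-k\<close> or \<open>k\<close>, and that it is
  determined up to finitely many terms by its direction and its eventual lamp configuration; two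
  rays that do not eventually coincide satisfy \<open>d(\<gamma> n, \<gamma>' j) \<ge> n + j - c\<close>. This dichotomy makes the
  Busemann function well defined on classes, and it gives injectivity because \<open>b\<^sup>\<gamma> (\<gamma> n) = -n\<close>.

  For an upward ray, \<open>b\<^sup>\<gamma> x = H x - 2 m - 2 k\<close>, where \<open>m\<close> is the smaller of \<open>H x\<close> and the first position
  at which \<open>x\<close> and the eventual configuration differ, so only finitely many lamps matter up to the
  (locally constant) turning point. This yields continuity on upward rays, and the reflection
  \<open>i \<mapsto> -1 - i\<close> transfers it to downward rays. Continuity fails at the ray \<open>t\<^sup>n\<close>, which is the limit
  of the rays that climb to height \<open>k\<close>, light the lamp \<open>k - 1\<close> and go back down for ever.
\<close>

section \<open>The distance formula\<close>

definition spans :: "int \<Rightarrow> int \<Rightarrow> lampstand \<Rightarrow> lampstand \<Rightarrow> bool" where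
  "spans lo hi g h \<longleftrightarrow>
     lo \<le> height g \<and> lo \<le> height h \<and> height g \<le> hi \<and> height h \<le> hi \<and>
     (\<forall>i. (i |\<in>| lit g) \<noteq> (i |\<in>| lit h) \<longrightarrow> lo \<le> i \<and> i < hi)"

lemma spans_length: "spans lo hi g h \<Longrightarrow> \<bar>height g - height h\<bar> \<le> 2 * (hi - lo) - \<bar>height g - height h\<bar>"
  by (auto simp: spans_def abs_if)

lemma inv_lamp_mult: "lamp_mult (inv\<^bsub>L2\<^esub> g) (lamp_mult g h) = h"
  using group.inv_solve_left [OF group_L2, of h g "lamp_mult g h"] by simp

text \<open>The inverse of at is t^-1 a: it steps down first and then toggles the lamp it reaches,
  so a step down from height h acts on lamp h - 1.\<close>

lemma gens_iff:
  "gens \<union> m_inv L2 ` gens =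
     {Lampstand {||} 1, Lampstand {|0|} 1, Lampstand {||} (-1), Lampstand {|-1|} (-1)}"
proof -
  have gens: "gens = {Lampstand {||} 1, Lampstand {|0|} 1}"
    unfolding gens_def by (auto simp: gen_t_def gen_a_def intro!: lampstand_eqI)
  have "inv\<^bsub>L2\<^esub> (Lampstand {||} 1) = Lampstand {||} (-1)"
    "inv\<^bsub>L2\<^esub> (Lampstand {|0|} 1) = Lampstand {|-1|} (-1)"
    by (rule group.inv_equality [OF group_L2]; auto intro!: lampstand_eqI)+
  then show ?thesis
    unfolding gens by auto
qed

lemma d2_commute: "d2 g h = d2 h g"
  using Metric_space.commute [OF Metric_space_d2] by auto

lemma d2_triangle: "d2 g k \<le> d2 g h + d2 h k"
  using Metric_space.triangle [OF Metric_space_d2] by auto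

lemma d2_eq_0_iff: "d2 g h = 0 \<longleftrightarrow> g = h"
  using Metric_space.zero [OF Metric_space_d2] by auto

lemma d2_lamp_mult_le:
  assumes "s \<in> gens \<union> m_inv L2 ` gens"
  shows "d2 g (lamp_mult g s) \<le> 1"
proof -
  have "word_length L2 gens s \<le> 1"
    unfolding word_length_def
    by (rule Least_le, rule exI [of _ "[s]"])
      (use assms in \<open>auto intro: lampstand_eqI\<close>)
  then show ?thesis
    by (simp add: d2_def word_dist_def inv_lamp_mult)
qed

text \<open>One upward generator keeps the crossed lamp and the other toggles it, so its final state
  can be prescribed.\<close>

lemma neighbour_up:
  obtains g' where "d2 g g' \<le> 1" "height g' = height g + 1" "height g |\<in>| lit g' \<longleftrightarrow> b"
    "\<And>i. i \<noteq> height g \<Longrightarrow> i |\<in>| lit g' \<longleftrightarrow> i |\<in>| lit g"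
proof -
  define s where "s = Lampstand (if (height g |\<in>| lit g) = b then {||} else {|0|}) 1"
  have "d2 g (lamp_mult g s) \<le> 1"
    by (rule d2_lamp_mult_le) (auto simp: gens_iff s_def)
  then show ?thesis
    by (rule that) (auto simp: s_def)
qed

lemma neighbour_down:
  obtains g' where "d2 g g' \<le> 1" "height g' = height g - 1" "height g - 1 |\<in>| lit g' \<longleftrightarrow> b"
    "\<And>i. i \<noteq> height g - 1 \<Longrightarrow> i |\<in>| lit g' \<longleftrightarrow> i |\<in>| lit g"
proof -
  define s where "s = Lampstand (if (height g - 1 |\<in>| lit g) = b then {||} else {|-1|}) (-1)"
  have "d2 g (lamp_mult g s) \<le> 1"
    by (rule d2_lamp_mult_le) (auto simp: gens_iff s_def)
  then show ?thesis
    by (rule that) (auto simp: s_def)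
qed

text \<open>The optimal walk first runs to the end of the interval that lies away from
  \<open>h\<close>. From there it crosses the outermost edge for the last time, sets that lamp as in
  \<open>h\<close>, and the interval shrinks.\<close>

lemma d2_le_aux:
  assumes "spans lo hi g h" "2 * (hi - lo) - \<bar>height g - height h\<bar> = int n"
  shows "d2 g h \<le> real n"
  using assms
proof (induction n arbitrary: lo hi g)
  case 0
  then have "hi = lo" "height g = height h" by (auto simp: spans_def)
  then have "g = h" using 0 by (intro lampstand_eqI) (auto simp: spans_def)
  then show ?case using d2_eq_0_iff [of g g] by simp
next
  case (Suc n)
  have step: "d2 g h \<le> real (Suc n)"
    if "d2 g g' \<le> 1" "spans lo' hi' g' h" "2 * (hi' - lo') - \<bar>height g' - height h\<bar> = int n"
    for g' lo' hi'
    using Suc.IH [OF that(2,3)] that(1) d2_triangle [of g h g'] by simp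
  \<comment> \<open>If the heights agree, the positive length gives \<open>lo < hi\<close>, so one
    of the first two cases applies.\<close>
  consider "height g \<le> height h" "lo < height g" | "height g \<ge> height h" "height g < hi"
    | "height g = lo" "height g < height h" | "height g = hi" "height g > height h"
    using Suc.prems by (auto simp: spans_def) linarith+
  then show ?case
  proof cases
    case 1
    \<comment> \<open>The state left behind is arbitrary: this edge lies below both heights and is
      crossed again on the way to \<open>h\<close>.\<close>
    obtain g' where g': "d2 g g' \<le> 1" "height g' = height g - 1"
      "\<And>i. i \<noteq> height g - 1 \<Longrightarrow> i |\<in>| lit g' \<longleftrightarrow> i |\<in>| lit g"
      by (rule neighbour_down [of g True]) blast
    have "spans lo hi g' h"
      unfolding spans_def
      using Suc.prems(1) 1 g'(2) g'(3)
      by (smt (verit, best) spans_def)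
    then show ?thesis using step [OF g'(1)] Suc.prems(2) 1 g'(2) by simp
  next
    case 2
    obtain g' where g': "d2 g g' \<le> 1" "height g' = height g + 1"
      "\<And>i. i \<noteq> height g \<Longrightarrow> i |\<in>| lit g' \<longleftrightarrow> i |\<in>| lit g"
      by (rule neighbour_up [of g True]) blast
    have "spans lo hi g' h"
      unfolding spans_def
      using Suc.prems(1) 2 g'(2) g'(3)
      by (smt (verit, best) spans_def)
    then show ?thesis using step [OF g'(1)] Suc.prems(2) 2 g'(2) by simp
  next
    case 3
    obtain g' where g': "d2 g g' \<le> 1" "height g' = height g + 1"
      "height g |\<in>| lit g' \<longleftrightarrow> height g |\<in>| lit h"
      "\<And>i. i \<noteq> height g \<Longrightarrow> i |\<in>| lit g' \<longleftrightarrow> i |\<in>| lit g"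
      by (rule neighbour_up [of g "height g |\<in>| lit h"]) blast
    have "spans (lo + 1) hi g' h"
      unfolding spans_def
      using Suc.prems(1) 3 g'(2,3,4)
      by (smt (verit, best) spans_def)
    then show ?thesis using step [OF g'(1)] Suc.prems(2) 3 g'(2) by simp
  next
    case 4
    obtain g' where g': "d2 g g' \<le> 1" "height g' = height g - 1"
      "height g - 1 |\<in>| lit g' \<longleftrightarrow> height g - 1 |\<in>| lit h"
      "\<And>i. i \<noteq> height g - 1 \<Longrightarrow> i |\<in>| lit g' \<longleftrightarrow> i |\<in>| lit g"
      by (rule neighbour_down [of g "height g - 1 |\<in>| lit h"]) blast
    have "spans lo (hi - 1) g' h"
      unfolding spans_def
      using Suc.prems(1) 4 g'(2,3,4)
      by (smt (verit, best) spans_def)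
    then show ?thesis using step [OF g'(1)] Suc.prems(2) 4 g'(2) by simp
  qed
qed

lemma d2_le:
  assumes "spans lo hi g h"
  shows "d2 g h \<le> real_of_int (2 * (hi - lo) - \<bar>height g - height h\<bar>)"
proof -
  have "2 * (hi - lo) - \<bar>height g - height h\<bar> \<ge> 0"
    using spans_length [OF assms] by (meson abs_ge_zero order_trans)
  then show ?thesis
    using d2_le_aux [OF assms] nat_0_le by (metis of_int_of_nat_eq)
qed

text \<open>The interval is the range swept by the walk that the word spells out. If a new first
  letter enlarges it, the walk starts at the new endpoint and moves away from it; the displacement
  then grows too, so the left-hand side grows by only one.\<close>

lemma word_spans:
  assumes "set ws \<subseteq> gens \<union> m_inv L2 ` gens"
  shows "\<exists>lo hi. spans lo hi g (lamp_mult g (foldr (mult L2) ws (one L2))) \<and>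
    2 * (hi - lo) - \<bar>height (foldr (mult L2) ws (one L2))\<bar> \<le> int (length ws)"
  using assms
proof (induction ws arbitrary: g)
  case Nil
  show ?case by (intro exI [of _ "height g"]) (auto simp: spans_def)
next
  case (Cons w ws)
  define x where "x = foldr lamp_mult ws (Lampstand {||} 0)"
  define g' where "g' = lamp_mult g w"
  have g'x: "lamp_mult g (lamp_mult w x) = lamp_mult g' x"
    by (rule lampstand_eqI) (auto simp: g'_def algebra_simps)
  have w: "height w = 1 \<and> (\<forall>i. i |\<in>| lit w \<longrightarrow> i = 0) \<or> height w = -1 \<and> (\<forall>i. i |\<in>| lit w \<longrightarrow> i = -1)"
    using Cons.prems by (auto simp: gens_iff)
  obtain lo hi where lh: "spans lo hi g' (lamp_mult g' x)" "2 * (hi - lo) - \<bar>height x\<bar> \<le> int (length ws)"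
    using Cons.IH [of g'] Cons.prems by (auto simp: x_def)
  \<comment> \<open>The edge between adjacent heights carries the index of its lower end, whichever
    way it is crossed.\<close>
  have "i = min (height g) (height g')" if "(i |\<in>| lit g) \<noteq> (i |\<in>| lit g')" for i
    using w that by (auto simp: g'_def)
  moreover have hg': "height g' = height g + height w" by (simp add: g'_def)
  ultimately have "spans (min lo (height g)) (max hi (height g)) g (lamp_mult g' x)"
    using lh(1) w unfolding spans_def min_def max_def by (smt (z3))
  moreover have "2 * (max hi (height g) - min lo (height g)) - \<bar>height w + height x\<bar> \<le> int (length (w # ws))"
    using lh w hg' by (auto simp: spans_def)
  ultimately show ?case
    by (intro exI conjI) (simp_all flip: x_def add: g'x)
qed

text \<open>The range swept by a shortest word attains the bound of \<open>d2_le\<close>. Lower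
  bounds on \<open>d2\<close> then follow from what every spanning interval must contain.\<close>

lemma d2_attained:
  obtains lo hi where "spans lo hi g h"
    "d2 g h = real_of_int (2 * (hi - lo) - \<bar>height g - height h\<bar>)"
proof -
  define x where "x = lamp_mult (inv\<^bsub>L2\<^esub> g) h"
  have h: "lamp_mult g x = h"
    using group.inv_solve_left [OF group_L2, of x g h] by (simp add: x_def)
  have "\<exists>n ws. length ws = n \<and> set ws \<subseteq> gens \<union> m_inv L2 ` gens \<and> foldr (mult L2) ws (one L2) = x"
    using gens_generate [of x] by auto
  from LeastI_ex [OF this]
  obtain ws where ws: "length ws = word_length L2 gens x" "set ws \<subseteq> gens \<union> m_inv L2 ` gens"
    "foldr (mult L2) ws (one L2) = x"
    unfolding word_length_def by auto
  obtain lo hi where lh: "spans lo hi g h" "2 * (hi - lo) - \<bar>height x\<bar> \<le> int (length ws)"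
    using word_spans [OF ws(2), of g] unfolding ws(3) h by blast
  have hx: "height x = height h - height g" using height_lamp_mult [of g x] by (simp add: h)
  have "d2 g h = real (length ws)"
    by (simp add: d2_def word_dist_def ws(1) x_def)
  then have "real_of_int (2 * (hi - lo) - \<bar>height g - height h\<bar>) \<le> d2 g h"
    using lh(2) hx by linarith
  with d2_le [OF lh(1)] show ?thesis
    using that [OF lh(1)] by linarith
qed

text \<open>The endpoint conditions force both ends into every spanning interval, so this one is the
  least. Lamp \<open>hi - 1\<close> is the edge that ends at \<open>hi\<close>.\<close>

lemma d2_eq:
  assumes spans: "spans lo hi g h"
    and lo: "lo = height g \<or> lo = height h \<or> (lo |\<in>| lit g) \<noteq> (lo |\<in>| lit h)"
    and hi: "hi = height g \<or> hi = height h \<or> (hi - 1 |\<in>| lit g) \<noteq> (hi - 1 |\<in>| lit h)"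
  shows "d2 g h = real_of_int (2 * (hi - lo) - \<bar>height g - height h\<bar>)"
proof (rule antisym [OF d2_le [OF spans]])
  obtain lo' hi' where lh: "spans lo' hi' g h"
    "d2 g h = real_of_int (2 * (hi' - lo') - \<bar>height g - height h\<bar>)"
    by (rule d2_attained)
  have "lo' \<le> lo" using lo lh(1) unfolding spans_def by blast
  moreover have "hi \<le> hi'" using hi lh(1) unfolding spans_def by fastforce
  ultimately show "real_of_int (2 * (hi - lo) - \<bar>height g - height h\<bar>) \<le> d2 g h"
    unfolding lh(2) of_int_le_iff by simp
qed

lemma d2_ge_height: "real_of_int \<bar>height g - height h\<bar> \<le> d2 g h"
proof -
  obtain lo hi where "spans lo hi g h"
    "d2 g h = real_of_int (2 * (hi - lo) - \<bar>height g - height h\<bar>)"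
    by (rule d2_attained)
  then show ?thesis using spans_length [of lo hi g h] by (simp only: of_int_le_iff)
qed

text \<open>Distances are integers. This reduces the topology on rays to agreement on initial
  segments.\<close>

lemma d2_less_1_iff: "d2 g h < 1 \<longleftrightarrow> g = h"
proof
  assume "d2 g h < 1"
  moreover obtain lo hi where eq: "d2 g h = real_of_int (2 * (hi - lo) - \<bar>height g - height h\<bar>)"
    by (rule d2_attained)
  ultimately have "2 * (hi - lo) - \<bar>height g - height h\<bar> < 1"
    by linarith
  moreover have "0 \<le> d2 g h"
    using d2_ge_height [of g h] by linarith
  then have "0 \<le> 2 * (hi - lo) - \<bar>height g - height h\<bar>"
    unfolding eq by linarith
  ultimately have "d2 g h = 0"
    unfolding eq by simp
  then show "g = h"
    by (simp add: d2_eq_0_iff)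
qed (use d2_eq_0_iff [of g h] in simp)

lemma d2_eq_1D:
  assumes "d2 g h = 1"
  shows "\<bar>height g - height h\<bar> = 1"
    and "(i |\<in>| lit g) \<noteq> (i |\<in>| lit h) \<Longrightarrow> i = min (height g) (height h)"
proof -
  obtain lo hi where lh: "spans lo hi g h"
    "d2 g h = real_of_int (2 * (hi - lo) - \<bar>height g - height h\<bar>)"
    by (rule d2_attained)
  then have eq: "2 * (hi - lo) - \<bar>height g - height h\<bar> = 1" using assms by linarith
  then show 1: "\<bar>height g - height h\<bar> = 1" using spans_length [OF lh(1)] by presburger
  assume "(i |\<in>| lit g) \<noteq> (i |\<in>| lit h)"
  then show "i = min (height g) (height h)"
    using lh(1) eq 1 by (auto simp: spans_def)
qed

section \<open>The shape of geodesic rays\<close>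

lemma ray_0: "\<gamma> \<in> based_rays \<Longrightarrow> \<gamma> 0 = Lampstand {||} 0"
  by (simp add: based_rays_def)

lemma ray_dist: "\<gamma> \<in> based_rays \<Longrightarrow> d2 (\<gamma> m) (\<gamma> n) = \<bar>real m - real n\<bar>"
  by (simp add: based_rays_def)

lemma ray_height_lipschitz:
  assumes "\<gamma> \<in> based_rays"
  shows "\<bar>height (\<gamma> m) - height (\<gamma> n)\<bar> \<le> \<bar>int m - int n\<bar>"
  using d2_ge_height [of "\<gamma> m" "\<gamma> n"] unfolding ray_dist [OF assms] by linarith

lemma ray_height_step:
  assumes "\<gamma> \<in> based_rays"
  shows "\<bar>height (\<gamma> (Suc n)) - height (\<gamma> n)\<bar> = 1"
  by (rule d2_eq_1D(1)) (simp add: ray_dist [OF assms])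

lemma ray_lit_step:
  assumes "\<gamma> \<in> based_rays" "(i |\<in>| lit (\<gamma> (Suc n))) \<noteq> (i |\<in>| lit (\<gamma> n))"
  shows "i = min (height (\<gamma> (Suc n))) (height (\<gamma> n))"
  using assms(2) by (rule d2_eq_1D(2) [rotated]) (simp add: ray_dist [OF assms(1)])

text \<open>A lamp can be lit only after its edge has been crossed, and all edges crossed so far lie
  between \<open>A\<close> and \<open>B\<close>.\<close>

lemma ray_lit_range:
  assumes "\<gamma> \<in> based_rays" "\<And>j. j \<le> n \<Longrightarrow> A \<le> height (\<gamma> j) \<and> height (\<gamma> j) \<le> B"
    "i |\<in>| lit (\<gamma> n)"
  shows "A \<le> i \<and> i < B"
  using assms(2,3)
proof (induction n)
  case 0
  then show ?case by (simp add: ray_0 [OF assms(1)])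
next
  case (Suc n)
  show ?case
  proof (cases "i |\<in>| lit (\<gamma> n)")
    case True
    then show ?thesis using Suc by simp
  next
    case False
    then have "i = min (height (\<gamma> (Suc n))) (height (\<gamma> n))"
      using Suc.prems by (intro ray_lit_step [OF assms(1)]) simp
    then show ?thesis
      using Suc.prems(1) [of n] Suc.prems(1) [of "Suc n"] ray_height_step [OF assms(1), of n] by auto
  qed
qed

text \<open>
  A walk over \<open>[A, B]\<close> from \<open>0\<close> to a height \<open>h \<ge> 0\<close> takes at least \<open>2(B - A) - h\<close> steps, so a step away
  from \<open>0\<close> that does not enlarge \<open>[A, B]\<close> cannot increase the distance to the identity.
\<close>
lemma ray_record_up:
  assumes ray: "\<gamma> \<in> based_rays" and "height (\<gamma> n) \<ge> 0"
    and up: "height (\<gamma> (Suc n)) = height (\<gamma> n) + 1" and "j \<le> n"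
  shows "height (\<gamma> j) \<le> height (\<gamma> n)"
proof (rule ccontr)
  assume j: "\<not> height (\<gamma> j) \<le> height (\<gamma> n)"
  define S where "S = (\<lambda>i. height (\<gamma> i)) ` {..n}"
  have S: "finite S" "S \<noteq> {}" by (auto simp: S_def)
  from Min_in [OF S] obtain a where a: "a \<le> n" "Min S = height (\<gamma> a)"
    unfolding S_def by blast
  from Max_in [OF S] obtain b where b: "b \<le> n" "Max S = height (\<gamma> b)"
    unfolding S_def by blast
  have le: "Min S \<le> height (\<gamma> i) \<and> height (\<gamma> i) \<le> Max S" if "i \<le> n" for i
    using S(1) that by (auto simp: S_def)
  \<comment> \<open>The assumption \<open>j\<close> puts the new height at or below that of time
    \<open>j\<close>, so the step stays in the visited range.\<close>
  have range: "Min S \<le> height (\<gamma> i) \<and> height (\<gamma> i) \<le> Max S" if "i \<le> Suc n" for i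
    using le [of i] le [of n] le [OF \<open>j \<le> n\<close>] j up that by (cases "i = Suc n") auto
  have "spans (Min S) (Max S) (\<gamma> 0) (\<gamma> (Suc n))"
    using ray_lit_range [OF ray range] range [of 0] range [of "Suc n"]
    unfolding spans_def by (auto simp: ray_0 [OF ray])
  from d2_le [OF this] have "int n + 1 \<le> 2 * (Max S - Min S) - (height (\<gamma> n) + 1)"
    using assms(2) unfolding ray_dist [OF ray] up by (simp add: ray_0 [OF ray])
  \<comment> \<open>Three legs are added up: from 0 to one extreme, to the other extreme, to the
    height at time n. If the maximum comes first they give 2(Max - Min) plus that height, which is
    no smaller.\<close>
  moreover have "2 * (Max S - Min S) - height (\<gamma> n) \<le> int n"
    using ray_height_lipschitz [OF ray, of 0 a] ray_height_lipschitz [OF ray, of 0 b]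
      ray_height_lipschitz [OF ray, of a b] ray_height_lipschitz [OF ray, of a n]
      ray_height_lipschitz [OF ray, of b n] a b assms(2) le [of 0]
    by (cases "a \<le> b") (auto simp: ray_0 [OF ray])
  ultimately show False by linarith
qed

text \<open>As lamps sit on edges, the reflection of positions \<open>j \<mapsto> -j\<close> maps lamp \<open>i\<close> to lamp \<open>-1 - i\<close>.\<close>
definition reflect :: "lampstand \<Rightarrow> lampstand" where
  "reflect g = Lampstand ((\<lambda>i. - 1 - i) |`| lit g) (- height g)"

lemma height_reflect [simp]: "height (reflect g) = - height g"
  by (simp add: reflect_def)

lemma in_lit_reflect [simp]: "i |\<in>| lit (reflect g) \<longleftrightarrow> - 1 - i |\<in>| lit g"
  unfolding reflect_def by (auto simp: image_iff intro!: bexI [of _ "- 1 - i"])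

lemma reflect_reflect [simp]: "reflect (reflect g) = g"
  by (rule lampstand_eqI) auto

lemma reflect_comp_comp [simp]: "reflect \<circ> (reflect \<circ> f) = f"
  by (simp add: fun_eq_iff)

lemma spans_reflect: "spans lo hi g h \<Longrightarrow> spans (- hi) (- lo) (reflect g) (reflect h)"
  unfolding spans_def by force

lemma d2_reflect_le: "d2 (reflect g) (reflect h) \<le> d2 g h"
proof -
  obtain lo hi where "spans lo hi g h"
    "d2 g h = real_of_int (2 * (hi - lo) - \<bar>height g - height h\<bar>)"
    by (rule d2_attained)
  then show ?thesis
    using d2_le [OF spans_reflect [of lo hi g h]] by simp
qed

lemma d2_reflect [simp]: "d2 (reflect g) (reflect h) = d2 g h"
  using d2_reflect_le [of g h] d2_reflect_le [of "reflect g" "reflect h"] by simp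

lemma reflect_one [simp]: "reflect (Lampstand {||} 0) = Lampstand {||} 0"
  by (simp add: reflect_def)

lemma reflect_based_rays [simp]: "reflect \<circ> \<gamma> \<in> based_rays \<longleftrightarrow> \<gamma> \<in> based_rays"
  proof -
  have "reflect (\<gamma> 0) = Lampstand {||} 0 \<longleftrightarrow> \<gamma> 0 = Lampstand {||} 0"
    by (metis reflect_one reflect_reflect)
  then show ?thesis by (simp add: based_rays_def)
qed

lemma ray_record_down:
  assumes "\<gamma> \<in> based_rays" "height (\<gamma> n) \<le> 0" "height (\<gamma> (Suc n)) = height (\<gamma> n) - 1" "j \<le> n"
  shows "height (\<gamma> n) \<le> height (\<gamma> j)"
  using ray_record_up [of "reflect \<circ> \<gamma>" n j] assms by simp

text \<open>A second turn at a height in [0, k) would step up below the record k. After a second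
  turn below 0 the ray is driven back to 0 and has no admissible step there.\<close>

lemma ray_after_turn:
  assumes ray: "\<gamma> \<in> based_rays" and "k > 0" "height (\<gamma> k) = int k"
    and "height (\<gamma> (Suc k)) = int k - 1"
  shows "height (\<gamma> (k + j)) = int k - int j"
proof (induction j rule: less_induct)
  case (less j)
  show ?case
  proof (cases "j \<le> 1")
    case True
    then show ?thesis using assms by (cases j) auto
  next
    case False
    then obtain l where l: "j = Suc l" "l \<ge> 1" by (cases j) auto
    have hl: "height (\<gamma> (k + l)) = int k - int l" using less l by simp
    show ?thesis
    proof (rule ccontr)
      assume "height (\<gamma> (k + j)) \<noteq> int k - int j"
      then have up: "height (\<gamma> (Suc (k + l))) = height (\<gamma> (k + l)) + 1"
        using ray_height_step [OF ray, of "k + l"] l hl by auto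
      show False
      proof (cases "l \<le> k")
        case True
        then show False using ray_record_up [OF ray _ up, of k] hl l assms by simp
      next
        case False
        \<comment> \<open>The walk is forced back to \<open>0\<close>, where both continuations violate the record property.\<close>
        have return: "height (\<gamma> (k + l + i)) = int k - int l + int i" if "1 \<le> i" "i \<le> l - k" for i
          using that
        proof (induction i rule: dec_induct)
          case base
          then show ?case using up hl by simp
        next
          case (step i)
          then have hi: "height (\<gamma> (k + l + i)) = int k - int l + int i" by simp
          \<comment> \<open>At a nonpositive height a step down is allowed only from the minimum so
            far, but the lower height k - l was reached at time k + l.\<close>
          have "int k - int l + int i \<le> 0" using step by linarith
          then have "height (\<gamma> (Suc (k + l + i))) \<noteq> height (\<gamma> (k + l + i)) - 1"
            using ray_record_down [OF ray, of "k + l + i" "k + l"] hi hl step by auto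
          then show ?case using ray_height_step [OF ray, of "k + l + i"] hi by auto
        qed
        define n where "n = k + l + (l - k)"
        have n: "height (\<gamma> n) = 0" using return [of "l - k"] False by (auto simp: n_def)
        have "height (\<gamma> (Suc n)) \<noteq> height (\<gamma> n) + 1"
          using ray_record_up [OF ray, of n k] n assms by (auto simp: n_def)
        moreover have "height (\<gamma> (Suc n)) \<noteq> height (\<gamma> n) - 1"
          using ray_record_down [OF ray, of n "k + l"] n hl False by (auto simp: n_def)
        ultimately show False using ray_height_step [OF ray, of n] by linarith
      qed
    qed
  qed
qed

text \<open>The ray descends to height -k, turns there and climbs for ever; k = 0 is the ray that
  climbs from the start.\<close>

definition up_ray :: "nat \<Rightarrow> (nat \<Rightarrow> lampstand) \<Rightarrow> bool" where
  "up_ray k \<gamma> \<longleftrightarrow> \<gamma> \<in> based_rays \<and> (\<forall>n. height (\<gamma> n) = \<bar>int n - int k\<bar> - int k)"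

abbreviation down_ray :: "nat \<Rightarrow> (nat \<Rightarrow> lampstand) \<Rightarrow> bool" where
  "down_ray k \<gamma> \<equiv> up_ray k (reflect \<circ> \<gamma>)"

lemma up_ray_ray: "up_ray k \<gamma> \<Longrightarrow> \<gamma> \<in> based_rays"
  by (simp add: up_ray_def)

lemma up_ray_height: "up_ray k \<gamma> \<Longrightarrow> height (\<gamma> n) = \<bar>int n - int k\<bar> - int k"
  by (simp add: up_ray_def)

lemma down_ray_height: "down_ray k \<gamma> \<Longrightarrow> height (\<gamma> n) = int k - \<bar>int n - int k\<bar>"
  using up_ray_height [of k "reflect \<circ> \<gamma>" n] by simp

text \<open>The first step that fails to climb marks the turn of a downward ray; it is not step 0,
  so \<open>ray_after_turn\<close> applies.\<close>

lemma ray_cases_up: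
  assumes ray: "\<gamma> \<in> based_rays" and 1: "height (\<gamma> 1) = 1"
  shows "\<exists>k. up_ray k \<gamma> \<or> down_ray k \<gamma>"
proof (cases "\<forall>n. height (\<gamma> (Suc n)) = height (\<gamma> n) + 1")
  case True
  have "height (\<gamma> n) = int n" for n
    by (induction n) (use True in \<open>auto simp: ray_0 [OF ray]\<close>)
  then show ?thesis using ray by (auto simp: up_ray_def intro!: exI [of _ 0])
next
  case False
  define k where "k = (LEAST n. height (\<gamma> (Suc n)) \<noteq> height (\<gamma> n) + 1)"
  have k: "height (\<gamma> (Suc k)) \<noteq> height (\<gamma> k) + 1"
    unfolding k_def by (rule LeastI_ex) (use False in auto)
  have less: "height (\<gamma> (Suc n)) = height (\<gamma> n) + 1" if "n < k" for n
    using not_less_Least that unfolding k_def by blast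
  have le: "height (\<gamma> n) = int n" if "n \<le> k" for n
    using that by (induction n) (use less in \<open>auto simp: ray_0 [OF ray]\<close>)
  have "k > 0" using k 1 by (cases k) (auto simp: ray_0 [OF ray])
  moreover have "height (\<gamma> (Suc k)) = int k - 1"
    using k le [of k] ray_height_step [OF ray, of k] by auto
  ultimately have after: "height (\<gamma> (k + j)) = int k - int j" for j
    using le [of k] by (intro ray_after_turn [OF ray]) auto
  have "height (\<gamma> n) = int k - \<bar>int n - int k\<bar>" for n
    using le [of n] after [of "n - k"] by (cases "n \<le> k") auto
  then show ?thesis using ray by (auto simp: up_ray_def intro!: exI [of _ k])
qed

lemma ray_cases:
  assumes "\<gamma> \<in> based_rays"
  obtains k where "up_ray k \<gamma>" | k where "down_ray k \<gamma>"
proof -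
  have "\<exists>k. up_ray k \<gamma> \<or> down_ray k \<gamma>"
  proof (cases "height (\<gamma> 1) = 1")
    case False
    then have "height ((reflect \<circ> \<gamma>) 1) = 1"
      using ray_height_step [OF assms, of 0] by (auto simp: ray_0 [OF assms])
    from ray_cases_up [of "reflect \<circ> \<gamma>"] this assms show ?thesis by auto
  qed (use ray_cases_up [OF assms] in blast)
  then show ?thesis using that by blast
qed

section \<open>Eventual lamp configurations\<close>

definition eventually_lit :: "(nat \<Rightarrow> lampstand) \<Rightarrow> int \<Rightarrow> bool" where
  "eventually_lit \<gamma> i \<longleftrightarrow> (\<forall>\<^sub>F n in sequentially. i |\<in>| lit (\<gamma> n))"

text \<open>From time k on the ray only climbs, so edges below its current height are never crossed
  again.\<close>

lemma up_ray_settled: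
  assumes "up_ray k \<gamma>" "k \<le> n" "n \<le> m" "i < height (\<gamma> n)"
  shows "i |\<in>| lit (\<gamma> m) \<longleftrightarrow> i |\<in>| lit (\<gamma> n)"
  using assms(3)
proof (induction m rule: dec_induct)
  case (step m)
  have "i \<noteq> min (height (\<gamma> (Suc m))) (height (\<gamma> m))"
    using assms(2,4) step(1) by (simp add: up_ray_height [OF assms(1)])
  then show ?case
    using ray_lit_step [OF up_ray_ray [OF assms(1)], of i m] step by auto
qed simp

lemma up_ray_eventually_lit:
  assumes "up_ray k \<gamma>" "k \<le> n" "i < height (\<gamma> n)"
  shows "i |\<in>| lit (\<gamma> n) \<longleftrightarrow> eventually_lit \<gamma> i"
proof
  assume "i |\<in>| lit (\<gamma> n)"
  then show "eventually_lit \<gamma> i"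
    unfolding eventually_lit_def eventually_sequentially
    using up_ray_settled [OF assms(1,2) _ assms(3)] by blast
next
  assume "eventually_lit \<gamma> i"
  then obtain N where "\<And>m. m \<ge> N \<Longrightarrow> i |\<in>| lit (\<gamma> m)"
    unfolding eventually_lit_def eventually_sequentially by blast
  then show "i |\<in>| lit (\<gamma> n)"
    using up_ray_settled [OF assms(1,2) _ assms(3), of "max N n"] by simp
qed

text \<open>At time 2k the ray is back at height 0; from then on its current height is the maximum
  so far.\<close>

lemma up_ray_lit_range:
  assumes "up_ray k \<gamma>" "2 * k \<le> n" "i |\<in>| lit (\<gamma> n)"
  shows "- int k \<le> i" "i < height (\<gamma> n)"
proof -
  have "- int k \<le> i \<and> i < height (\<gamma> n)"
    by (rule ray_lit_range [OF up_ray_ray [OF assms(1)] _ assms(3)])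
      (use assms(2) in \<open>auto simp: up_ray_height [OF assms(1)]\<close>)
  then show "- int k \<le> i" "i < height (\<gamma> n)" by auto
qed

lemma up_ray_in_lit_iff:
  assumes "up_ray k \<gamma>" "2 * k \<le> n"
  shows "i |\<in>| lit (\<gamma> n) \<longleftrightarrow> eventually_lit \<gamma> i \<and> i < height (\<gamma> n)"
  using up_ray_lit_range(2) [OF assms] up_ray_eventually_lit [OF assms(1)] assms(2) by fastforce

lemma up_ray_eventually_lit_ge:
  assumes "up_ray k \<gamma>" "eventually_lit \<gamma> i"
  shows "- int k \<le> i"
proof -
  from assms(2) obtain N where "i |\<in>| lit (\<gamma> (max N (2 * k)))"
    unfolding eventually_lit_def eventually_sequentially by (meson max.cobounded1)
  then show ?thesis by (rule up_ray_lit_range(1) [OF assms(1), rotated]) simp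
qed

text \<open>This is the lowest point of a shortest path from x to a distant point of an upward ray
  with eventual configuration \<open>E\<close>. It is capped at \<open>height x\<close> because the
  edges above are crossed in any case.\<close>

definition first_difference :: "(int \<Rightarrow> bool) \<Rightarrow> lampstand \<Rightarrow> int \<Rightarrow> bool" where
  "first_difference E x m \<longleftrightarrow> m \<le> height x \<and> (\<forall>i<m. E i = (i |\<in>| lit x)) \<and>
     (m = height x \<or> E m \<noteq> (m |\<in>| lit x))"

text \<open>Allowing two configurations also records that m depends only on lamps below
  \<open>height x\<close>, as continuity requires.\<close>

lemma first_difference_unique:
  assumes "first_difference E x m" "first_difference E' x m'" "\<And>i. i < height x \<Longrightarrow> E i = E' i"
  shows "m = m'"
  proof -
  have m: "m \<le> height x" "\<And>i. i < m \<Longrightarrow> E i = (i |\<in>| lit x)" "m \<noteq> height x \<Longrightarrow> E m \<noteq> (m |\<in>| lit x)"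
    and m': "m' \<le> height x" "\<And>i. i < m' \<Longrightarrow> E' i = (i |\<in>| lit x)" "m' \<noteq> height x \<Longrightarrow> E' m' \<noteq> (m' |\<in>| lit x)"
    using assms(1,2) by (auto simp: first_difference_def)
  have "\<not> m < m'" using m(3) m'(1) m'(2) [of m] assms(3) [of m] by auto
  moreover have "\<not> m' < m" using m'(3) m(1) m(2) [of m'] assms(3) [of m'] by auto
  ultimately show ?thesis by simp
qed

text \<open>The lower bound on \<open>E\<close> leaves only finitely many differences below
  \<open>height x\<close>, so there is a least one.\<close>

lemma first_difference_exists:
  assumes "\<And>i. E i \<Longrightarrow> A \<le> i"
  shows "\<exists>m. first_difference E x m"
proof -
  define S where "S = insert (height x) {i. i < height x \<and> E i \<noteq> (i |\<in>| lit x)}"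
  have "S \<subseteq> {A..height x} \<union> fset (lit x) \<union> {height x}"
    using assms by (auto simp: S_def)
  then have fin: "finite S" by (rule finite_subset) simp
  have "Min S \<in> S" by (rule Min_in [OF fin]) (simp add: S_def)
  moreover have "Min S \<le> i" if "i \<in> S" for i using fin that by simp
  moreover have "i \<in> S \<longleftrightarrow> i = height x \<or> i < height x \<and> E i \<noteq> (i |\<in>| lit x)" for i
    by (auto simp: S_def)
  ultimately have "first_difference E x (Min S)"
    unfolding first_difference_def by (smt (verit, ccfv_SIG))
  then show ?thesis ..
qed

text \<open>Once the ray is above x and all its lit lamps, the least spanning interval runs from m
  to the current height.\<close>

lemma up_ray_eventual_dist:
  assumes "up_ray k \<gamma>" "first_difference (eventually_lit \<gamma>) x m"
  shows "\<forall>\<^sub>F n in sequentially. d2 (\<gamma> n) x = real_of_int (height (\<gamma> n) + height x - 2 * m)"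
proof -
  obtain b where b: "\<And>i. i |\<in>| lit x \<Longrightarrow> i < b"
    using finite_fset [of "lit x"] by (meson bdd_above.E bdd_above_finite zle_add1_eq_le)
  \<comment> \<open>The ray is back at height 0 after 2k steps; the other terms lift it to
    \<open>height x\<close> and to \<open>b\<close> at least.\<close>
  define N where "N = 2 * k + nat \<bar>height x\<bar> + nat \<bar>b\<bar>"
  have "d2 (\<gamma> n) x = real_of_int (height (\<gamma> n) + height x - 2 * m)" if "n \<ge> N" for n
  proof -
    have n: "2 * k \<le> n" "height x \<le> height (\<gamma> n)" "b \<le> height (\<gamma> n)"
      using that by (auto simp: N_def up_ray_height [OF assms(1)])
    have lit: "i |\<in>| lit (\<gamma> n) \<longleftrightarrow> eventually_lit \<gamma> i \<and> i < height (\<gamma> n)" for i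
      by (rule up_ray_in_lit_iff [OF assms(1) n(1)])
    have m: "m \<le> height x" "\<And>i. i < m \<Longrightarrow> eventually_lit \<gamma> i = (i |\<in>| lit x)"
      "m = height x \<or> eventually_lit \<gamma> m \<noteq> (m |\<in>| lit x)"
      using assms(2) by (auto simp: first_difference_def)
    have "m \<le> i \<and> i < height (\<gamma> n)" if "(i |\<in>| lit (\<gamma> n)) \<noteq> (i |\<in>| lit x)" for i
      using that lit [of i] m(1) m(2) [of i] b [of i] n(2,3) by (cases "i < m") auto
    then have "spans m (height (\<gamma> n)) (\<gamma> n) x"
      using m(1) n by (auto simp: spans_def)
    moreover have "m = height x \<or> (m |\<in>| lit (\<gamma> n)) \<noteq> (m |\<in>| lit x)"
      using m(1,3) lit [of m] n(2) by auto
    ultimately have "d2 (\<gamma> n) x =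
        real_of_int (2 * (height (\<gamma> n) - m) - \<bar>height (\<gamma> n) - height x\<bar>)"
      by (intro d2_eq) auto
    then show ?thesis using n(2) by simp
  qed
  then show ?thesis unfolding eventually_sequentially by blast
qed

lemma up_ray_tendsto:
  assumes "up_ray k \<gamma>" "first_difference (eventually_lit \<gamma>) x m"
  shows "(\<lambda>n. d2 (\<gamma> n) x - real n) \<longlonglongrightarrow> real_of_int (height x - 2 * m - 2 * int k)"
proof (rule tendsto_eventually)
  show "\<forall>\<^sub>F n in sequentially. d2 (\<gamma> n) x - real n = real_of_int (height x - 2 * m - 2 * int k)"
    using up_ray_eventual_dist [OF assms] eventually_ge_at_top [of k]
    by eventually_elim (simp add: up_ray_height [OF assms(1)])
qed

lemma ray_dist_0: "\<gamma> \<in> based_rays \<Longrightarrow> d2 (\<gamma> n) (Lampstand {||} 0) = real n"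
  using ray_dist [of \<gamma> n 0] by (simp add: ray_0)

text \<open>The Busemann function vanishes at the identity, which turns the limit formula into an
  equation for m. Geometrically, a turn at -k with k > 0 forces lamp -k to be lit, so the
  configuration determines k.\<close>

lemma up_ray_turn:
  assumes "up_ray k \<gamma>" "first_difference (eventually_lit \<gamma>) (Lampstand {||} 0) m"
  shows "m = - int k"
proof -
  have "(\<lambda>n. 0::real) \<longlonglongrightarrow> real_of_int (0 - 2 * m - 2 * int k)"
    using up_ray_tendsto [OF assms] by (simp add: ray_dist_0 [OF up_ray_ray [OF assms(1)]])
  then have "real_of_int (0 - 2 * m - 2 * int k) = 0"
    by (simp add: LIMSEQ_const_iff)
  then show ?thesis by linarith
qed

section \<open>Asymptotic rays\<close>

text \<open>The two times are independent: n = j refutes asymptoticity, while fixed n with j tending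
  to infinity separates Busemann functions.\<close>

definition diverging :: "(nat \<Rightarrow> lampstand) \<Rightarrow> (nat \<Rightarrow> lampstand) \<Rightarrow> bool" where
  "diverging \<gamma> \<gamma>' \<longleftrightarrow>
     (\<exists>c N. \<forall>n\<ge>N. \<forall>j\<ge>N. real n + real j - c \<le> d2 (\<gamma> n) (\<gamma>' j))"

lemma diverging_commute: "diverging \<gamma> \<gamma>' \<Longrightarrow> diverging \<gamma>' \<gamma>"
  unfolding diverging_def by (metis add.commute d2_commute)

lemma diverging_reflect [simp]: "diverging (reflect \<circ> \<gamma>) (reflect \<circ> \<gamma>') \<longleftrightarrow> diverging \<gamma> \<gamma>'"
  by (simp add: diverging_def)

text \<open>The rays disagree at lamp i for ever, so a path between distant points must come down to
  height i and climb back.\<close>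

lemma up_rays_diverging:
  assumes "up_ray k \<gamma>" "up_ray k' \<gamma>'" "eventually_lit \<gamma> i \<noteq> eventually_lit \<gamma>' i"
  shows "diverging \<gamma> \<gamma>'"
proof -
  define N where "N = 2 * k + 2 * k' + nat \<bar>i\<bar> + 1"
  define c where "c = real_of_int (2 * int k + 2 * int k' + 2 * i)"
  have "real n + real j - c \<le> d2 (\<gamma> n) (\<gamma>' j)" if "n \<ge> N" "j \<ge> N" for n j
  proof -
    have h: "height (\<gamma> n) = int n - 2 * int k" "height (\<gamma>' j) = int j - 2 * int k'"
      "i < height (\<gamma> n)" "i < height (\<gamma>' j)" "2 * k \<le> n" "2 * k' \<le> j"
      using that by (auto simp: N_def up_ray_height [OF assms(1)] up_ray_height [OF assms(2)])
    have "(i |\<in>| lit (\<gamma> n)) \<noteq> (i |\<in>| lit (\<gamma>' j))"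
      using assms(3) h by (simp add: up_ray_in_lit_iff [OF assms(1)] up_ray_in_lit_iff [OF assms(2)])
    moreover obtain lo hi where lh: "spans lo hi (\<gamma> n) (\<gamma>' j)"
      "d2 (\<gamma> n) (\<gamma>' j) = real_of_int (2 * (hi - lo) - \<bar>height (\<gamma> n) - height (\<gamma>' j)\<bar>)"
      by (rule d2_attained)
    ultimately have "lo \<le> i" "height (\<gamma> n) \<le> hi" "height (\<gamma>' j) \<le> hi"
      unfolding spans_def by blast+
    \<comment> \<open>Twice the larger of the two heights minus their difference is their
      sum.\<close>
    then have "height (\<gamma> n) + height (\<gamma>' j) - 2 * i \<le> 2 * (hi - lo) - \<bar>height (\<gamma> n) - height (\<gamma>' j)\<bar>"
      by (simp add: abs_if)
    then have "real_of_int (height (\<gamma> n) + height (\<gamma>' j) - 2 * i) \<le> d2 (\<gamma> n) (\<gamma>' j)"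
      unfolding lh(2) of_int_le_iff .
    then show ?thesis by (simp add: h(1,2) c_def)
  qed
  then show ?thesis unfolding diverging_def by blast
qed

lemma up_down_diverging:
  assumes "up_ray k \<gamma>" "down_ray k' \<gamma>'"
  shows "diverging \<gamma> \<gamma>'"
proof -
  have "real n + real j - real (2 * k + 2 * k') \<le> d2 (\<gamma> n) (\<gamma>' j)" if "n \<ge> 2 * k + 2 * k'" "j \<ge> 2 * k + 2 * k'" for n j
    using d2_ge_height [of "\<gamma> n" "\<gamma>' j"] that
    by (simp add: up_ray_height [OF assms(1)] down_ray_height [OF assms(2)])
  then show ?thesis unfolding diverging_def by blast
qed

text \<open>By \<open>up_ray_turn\<close> the turn is the first difference from the identity, which
  has height 0.\<close>

lemma up_ray_turn_cong:
  assumes "up_ray k \<gamma>" "up_ray k' \<gamma>'" "\<And>i. i < 0 \<Longrightarrow> eventually_lit \<gamma> i = eventually_lit \<gamma>' i"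
  shows "k = k'"
proof -
  obtain m where m: "first_difference (eventually_lit \<gamma>) (Lampstand {||} 0) m"
    using first_difference_exists up_ray_eventually_lit_ge [OF assms(1)] by blast
  obtain m' where m': "first_difference (eventually_lit \<gamma>') (Lampstand {||} 0) m'"
    using first_difference_exists up_ray_eventually_lit_ge [OF assms(2)] by blast
  show ?thesis
    using first_difference_unique [OF m m'] assms(3) up_ray_turn [OF assms(1) m]
      up_ray_turn [OF assms(2) m'] by simp
qed

lemma up_rays_eventually_eq:
  assumes "up_ray k \<gamma>" "up_ray k' \<gamma>'" "eventually_lit \<gamma> = eventually_lit \<gamma>'"
  shows "\<forall>\<^sub>F n in sequentially. \<gamma> n = \<gamma>' n"
proof -
  have k: "k = k'" using up_ray_turn_cong [OF assms(1,2)] assms(3) by simp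
  show ?thesis
    using eventually_ge_at_top [of "2 * k"]
  proof eventually_elim
    case (elim n)
    then show ?case
      using assms up_ray_in_lit_iff [OF assms(1), of n] up_ray_in_lit_iff [OF assms(2), of n]
      by (intro lampstand_eqI) (simp_all add: up_ray_height [OF assms(1)] up_ray_height [OF assms(2)] k)
  qed
qed

lemma up_rays_dichotomy:
  assumes "up_ray k \<gamma>" "up_ray k' \<gamma>'"
  shows "(\<forall>\<^sub>F n in sequentially. \<gamma> n = \<gamma>' n) \<or> diverging \<gamma> \<gamma>'"
  using up_rays_diverging [OF assms] up_rays_eventually_eq [OF assms] by blast

lemma ray_dichotomy:
  assumes "\<gamma> \<in> based_rays" "\<gamma>' \<in> based_rays"
  shows "(\<forall>\<^sub>F n in sequentially. \<gamma> n = \<gamma>' n) \<or> diverging \<gamma> \<gamma>'"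
proof -
  have "reflect g = reflect h \<longleftrightarrow> g = h" for g h
    by (metis reflect_reflect)
  then show ?thesis
    using up_rays_dichotomy [of _ "reflect \<circ> \<gamma>" _ "reflect \<circ> \<gamma>'"]
    by (cases rule: ray_cases [OF assms(1)]; cases rule: ray_cases [OF assms(2)])
      (auto dest: up_rays_dichotomy up_down_diverging intro: diverging_commute)
qed

lemma asymptotic_iff:
  assumes "\<gamma> \<in> based_rays" "\<gamma>' \<in> based_rays"
  shows "(\<gamma>, \<gamma>') \<in> asymptotic \<longleftrightarrow> (\<forall>\<^sub>F n in sequentially. \<gamma> n = \<gamma>' n)"
proof
  assume "(\<gamma>, \<gamma>') \<in> asymptotic"
  then obtain M where M: "\<And>n. d2 (\<gamma> n) (\<gamma>' n) \<le> M"
    by (auto simp: asymptotic_def bdd_above_def)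
  have "\<not> diverging \<gamma> \<gamma>'"
  proof
    assume "diverging \<gamma> \<gamma>'"
    then obtain c N where N: "real n + real n - c \<le> d2 (\<gamma> n) (\<gamma>' n)" if "n \<ge> N" for n
      unfolding diverging_def by blast
    obtain n where "real n > \<bar>M + c\<bar>" using reals_Archimedean2 by blast
    then show False using N [of "max n N"] M [of "max n N"] by (auto simp: max_def split: if_splits)
  qed
  then show "\<forall>\<^sub>F n in sequentially. \<gamma> n = \<gamma>' n" using ray_dichotomy [OF assms] by blast
next
  assume "\<forall>\<^sub>F n in sequentially. \<gamma> n = \<gamma>' n"
  then have "\<forall>\<^sub>F n in sequentially. d2 (\<gamma> n) (\<gamma>' n) = 0"
    by eventually_elim (simp add: d2_eq_0_iff)
  then have "(\<lambda>n. d2 (\<gamma> n) (\<gamma>' n)) \<longlonglongrightarrow> 0" by (rule tendsto_eventually)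
  then have "bounded (range (\<lambda>n. d2 (\<gamma> n) (\<gamma>' n)))"
    by (rule convergent_imp_bounded)
  then show "(\<gamma>, \<gamma>') \<in> asymptotic"
    using assms bounded_imp_bdd_above by (auto simp: asymptotic_def)
qed

lemma asymptotic_reflect: "(\<gamma>, \<gamma>') \<in> asymptotic \<Longrightarrow> (reflect \<circ> \<gamma>, reflect \<circ> \<gamma>') \<in> asymptotic"
  by (simp add: asymptotic_def)

section \<open>Busemann functions\<close>

definition busemann :: "(nat \<Rightarrow> lampstand) \<Rightarrow> lampstand \<Rightarrow> real" where
  "busemann \<gamma> x = lim (\<lambda>n. d2 (\<gamma> n) x - d2 (\<gamma> n) (Lampstand {||} 0))"

lemma busemann_reflect: "busemann (reflect \<circ> \<gamma>) (reflect x) = busemann \<gamma> x"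
proof -
  have "d2 (reflect g) (Lampstand {||} 0) = d2 g (Lampstand {||} 0)" for g
    by (metis d2_reflect reflect_one)
  then show ?thesis by (simp add: busemann_def)
qed

lemma up_ray_convergent:
  assumes "up_ray k \<gamma>"
  shows "convergent (\<lambda>n. d2 (\<gamma> n) x - real n)"
proof -
  obtain m where "first_difference (eventually_lit \<gamma>) x m"
    using first_difference_exists up_ray_eventually_lit_ge [OF assms] by blast
  from up_ray_tendsto [OF assms this] show ?thesis by (rule convergentI)
qed

lemma busemann_tendsto:
  assumes "\<gamma> \<in> based_rays"
  shows "(\<lambda>n. d2 (\<gamma> n) x - real n) \<longlonglongrightarrow> busemann \<gamma> x"
proof -
  have "convergent (\<lambda>n. d2 (\<gamma> n) x - real n)"
    using assms
  proof (cases rule: ray_cases)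
    case (2 k)
    from up_ray_convergent [OF this, of "reflect x"] show ?thesis by simp
  qed (rule up_ray_convergent)
  then show ?thesis
    by (simp add: busemann_def ray_dist_0 [OF assms] convergent_LIMSEQ_iff)
qed

lemma busemann_cong:
  assumes "(\<gamma>, \<gamma>') \<in> asymptotic"
  shows "busemann \<gamma> = busemann \<gamma>'"
proof
  fix x
  have rays: "\<gamma> \<in> based_rays" "\<gamma>' \<in> based_rays" using assms by (auto simp: asymptotic_def)
  have "\<forall>\<^sub>F n in sequentially. \<gamma> n = \<gamma>' n" using assms asymptotic_iff [OF rays] by simp
  then have "\<forall>\<^sub>F n in sequentially. d2 (\<gamma> n) x - real n = d2 (\<gamma>' n) x - real n"
    by eventually_elim simp
  with busemann_tendsto [OF rays(1)] have "(\<lambda>n. d2 (\<gamma>' n) x - real n) \<longlonglongrightarrow> busemann \<gamma> x"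
    by (rule Lim_transform_eventually)
  then show "busemann \<gamma> x = busemann \<gamma>' x"
    using busemann_tendsto [OF rays(2)] LIMSEQ_unique by blast
qed

lemma busemann_on_ray:
  assumes "\<gamma> \<in> based_rays"
  shows "busemann \<gamma> (\<gamma> n) = - real n"
proof (rule LIMSEQ_unique [OF busemann_tendsto [OF assms]], rule tendsto_eventually)
  show "\<forall>\<^sub>F j in sequentially. d2 (\<gamma> j) (\<gamma> n) - real j = - real n"
    using eventually_ge_at_top [of n] by eventually_elim (simp add: ray_dist [OF assms])
qed

text \<open>If the rays diverged, the Busemann function of \<gamma>' would be at least n - c at
  \<gamma> n, whereas that of \<gamma> is -n there.\<close>

lemma busemann_inj:
  assumes "\<gamma> \<in> based_rays" "\<gamma>' \<in> based_rays" "busemann \<gamma> = busemann \<gamma>'"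
  shows "(\<gamma>, \<gamma>') \<in> asymptotic"
proof -
  have "\<not> diverging \<gamma> \<gamma>'"
  proof
    assume "diverging \<gamma> \<gamma>'"
    then obtain c N where N: "\<And>n j. n \<ge> N \<Longrightarrow> j \<ge> N \<Longrightarrow> real n + real j - c \<le> d2 (\<gamma> n) (\<gamma>' j)"
      unfolding diverging_def by blast
    have "real n - c \<le> - real n" if "n \<ge> N" for n
    proof -
      have "(\<lambda>j. d2 (\<gamma>' j) (\<gamma> n) - real j) \<longlonglongrightarrow> - real n"
        using busemann_tendsto [OF assms(2)] busemann_on_ray [OF assms(1)] assms(3) by metis
      moreover have "real n - c \<le> d2 (\<gamma>' j) (\<gamma> n) - real j" if "j \<ge> N" for j
        using N [OF \<open>n \<ge> N\<close> that] d2_commute [of "\<gamma> n" "\<gamma>' j"] by simp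
      ultimately show ?thesis by (intro LIMSEQ_le_const) auto
    qed
    moreover obtain n where "real n > \<bar>c\<bar>" using reals_Archimedean2 by blast
    moreover have "real n \<le> real (max n N)" by simp
    ultimately show False by (smt (verit) max.cobounded2)
  qed
  then show ?thesis using ray_dichotomy [OF assms(1,2)] asymptotic_iff [OF assms(1,2)] by blast
qed

text \<open>Pointwise convergence along the ray is uniform on finite sets, which gives the closure.
  The function is unbounded below, while \<open>horo_embedding z\<close> is at least -d(z,
  id).\<close>

lemma busemann_horofunction:
  assumes ray: "\<gamma> \<in> based_rays"
  shows "busemann \<gamma> \<in> horofunction_boundary"
proof -
  have "busemann \<gamma> \<in> ucc_topology dist closure_of range horo_embedding"
    unfolding in_closure_of
  proof (intro conjI allI impI; (elim conjE)?)
    fix U assume "busemann \<gamma> \<in> U" "openin (ucc_topology dist) U"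
    then obtain K e where K: "finite K" "e > 0" "{g. \<forall>x\<in>K. dist (busemann \<gamma> x) (g x) < e} \<subseteq> U"
      unfolding openin_ucc_topology by blast
    have "\<forall>x\<in>K. \<forall>\<^sub>F n in sequentially. dist (d2 (\<gamma> n) x - real n) (busemann \<gamma> x) < e"
      using busemann_tendsto [OF ray] K(2) by (auto intro: tendstoD)
    then have "\<forall>\<^sub>F n in sequentially. \<forall>x\<in>K. dist (d2 (\<gamma> n) x - real n) (busemann \<gamma> x) < e"
      by (rule eventually_ball_finite [OF K(1)])
    then obtain n where "\<forall>x\<in>K. dist (d2 (\<gamma> n) x - real n) (busemann \<gamma> x) < e"
      using eventually_happens' [OF sequentially_bot] by blast
    then have "horo_embedding (\<gamma> n) \<in> U"
      by (intro subsetD [OF K(3)]) (simp add: horo_embedding_def ray_dist_0 [OF ray] dist_commute)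
    then show "\<exists>y. y \<in> range horo_embedding \<and> y \<in> U" by blast
  qed simp
  moreover have "busemann \<gamma> \<noteq> horo_embedding z" for z
  proof
    assume eq: "busemann \<gamma> = horo_embedding z"
    obtain n where "real n > d2 z (Lampstand {||} 0)" using reals_Archimedean2 by blast
    moreover have "- real n = d2 z (\<gamma> n) - d2 z (Lampstand {||} 0)"
      using busemann_on_ray [OF ray, of n] by (simp add: eq horo_embedding_def)
    moreover have "d2 z (\<gamma> n) \<ge> 0" using d2_ge_height [of z "\<gamma> n"] by linarith
    ultimately show False by linarith
  qed
  ultimately show ?thesis by (auto simp: horofunction_boundary_def)
qed

section \<open>Continuity on upward and downward rays\<close>

lemma openin_ray_topology:
  "openin ray_topology W \<longleftrightarrow> W \<subseteq> based_rays \<and>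
     (\<forall>\<gamma>\<in>W. \<exists>n. \<forall>\<gamma>'\<in>based_rays. (\<forall>j\<le>n. \<gamma>' j = \<gamma> j) \<longrightarrow> \<gamma>' \<in> W)"
proof (intro iffI conjI ballI; (elim conjE)?)
  assume "openin ray_topology W"
  then obtain U where U: "openin (ucc_topology d2) U" "W = U \<inter> based_rays"
    by (auto simp: ray_topology_def openin_subtopology)
  then show "W \<subseteq> based_rays" by simp
  fix \<gamma> assume "\<gamma> \<in> W"
  then have "\<gamma> \<in> U" using U(2) by simp
  from U(1) [unfolded openin_ucc_topology, rule_format, OF this]
  obtain K e where K: "finite K" "e > 0" "{g. \<forall>x\<in>K. d2 (\<gamma> x) (g x) < e} \<subseteq> U"
    by blast
  obtain n where n: "\<And>j. j \<in> K \<Longrightarrow> j \<le> n"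
    using K(1) unfolding finite_nat_set_iff_bounded_le by blast
  have "\<gamma>' \<in> W" if "\<gamma>' \<in> based_rays" "\<forall>j\<le>n. \<gamma>' j = \<gamma> j" for \<gamma>'
  proof -
    have "d2 (\<gamma> j) (\<gamma>' j) < e" if "j \<in> K" for j
      using n [OF that] \<open>\<forall>j\<le>n. \<gamma>' j = \<gamma> j\<close> K(2) d2_eq_0_iff [of "\<gamma> j" "\<gamma> j"] by simp
    then have "\<gamma>' \<in> U" by (intro subsetD [OF K(3)]) simp
    then show ?thesis using U(2) that(1) by simp
  qed
  then show "\<exists>n. \<forall>\<gamma>'\<in>based_rays. (\<forall>j\<le>n. \<gamma>' j = \<gamma> j) \<longrightarrow> \<gamma>' \<in> W" by blast
next
  assume W: "W \<subseteq> based_rays"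
    "\<forall>\<gamma>\<in>W. \<exists>n. \<forall>\<gamma>'\<in>based_rays. (\<forall>j\<le>n. \<gamma>' j = \<gamma> j) \<longrightarrow> \<gamma>' \<in> W"
  \<comment> \<open>An open set of arbitrary functions with trace \<open>W\<close> on the rays is
    needed: \<open>U\<close> collects those with an initial segment that forces every ray sharing it
    into \<open>W\<close>.\<close>
  define U where "U = {g. \<exists>n. \<forall>\<gamma>\<in>based_rays. (\<forall>j\<le>n. \<gamma> j = g j) \<longrightarrow> \<gamma> \<in> W}"
  have "openin (ucc_topology d2) U"
    unfolding openin_ucc_topology
  proof
    fix g assume "g \<in> U"
    then obtain n where n: "\<forall>\<gamma>\<in>based_rays. (\<forall>j\<le>n. \<gamma> j = g j) \<longrightarrow> \<gamma> \<in> W" by (auto simp: U_def)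
    have "{g'. \<forall>x\<in>{..n}. d2 (g x) (g' x) < 1} \<subseteq> U"
      using n by (auto simp: U_def d2_less_1_iff intro!: exI [of _ n])
    then show "\<exists>K e. finite K \<and> e > 0 \<and> {g'. \<forall>x\<in>K. d2 (g x) (g' x) < e} \<subseteq> U"
      by (intro exI [of _ "{..n}"] exI [of _ 1]) simp
  qed
  moreover have "W = U \<inter> based_rays"
    using W by (fastforce simp: U_def)
  ultimately show "openin ray_topology W"
    by (auto simp: ray_topology_def openin_subtopology)
qed

lemma up_ray_asymptotic:
  assumes up: "up_ray k \<gamma>" and asym: "(\<gamma>, \<gamma>') \<in> asymptotic"
  shows "up_ray k \<gamma>'" "eventually_lit \<gamma>' = eventually_lit \<gamma>"
proof -
  have rays: "\<gamma> \<in> based_rays" "\<gamma>' \<in> based_rays" using asym by (auto simp: asymptotic_def)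
  then obtain N where N: "\<And>n. n \<ge> N \<Longrightarrow> \<gamma> n = \<gamma>' n"
    using asym asymptotic_iff [OF rays] unfolding eventually_sequentially by blast
  show "up_ray k \<gamma>'"
    using rays(2)
  proof (cases rule: ray_cases)
    case (1 l)
    then have "k = l"
      using N [of "N + k + l"] up_ray_height [OF up, of "N + k + l"] up_ray_height [OF 1, of "N + k + l"] by simp
    with 1 show ?thesis by simp
  next
    case (2 l)
    then show ?thesis
      using N [of "N + 2 * k + 2 * l + 1"] up_ray_height [OF up, of "N + 2 * k + 2 * l + 1"]
        down_ray_height [OF 2, of "N + 2 * k + 2 * l + 1"] by simp
  qed
  have ev: "\<forall>\<^sub>F n in sequentially. \<gamma> n = \<gamma>' n"
    using N unfolding eventually_sequentially by blast
  show "eventually_lit \<gamma>' = eventually_lit \<gamma>"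
    unfolding eventually_lit_def by (intro ext eventually_subst) (use ev in eventually_elim, simp)
qed

text \<open>In the value H x - 2m - 2k, lamps below \<open>height x\<close> determine m and lamps
  below 0 determine k; \<open>N\<close> bounds both.\<close>

lemma up_ray_busemann_cong:
  assumes "up_ray k \<gamma>" "up_ray l \<gamma>'" "0 \<le> N" "height x \<le> N"
    and eq: "\<And>i. i < N \<Longrightarrow> eventually_lit \<gamma> i = eventually_lit \<gamma>' i"
  shows "busemann \<gamma> x = busemann \<gamma>' x"
proof -
  obtain m where m: "first_difference (eventually_lit \<gamma>) x m"
    using first_difference_exists up_ray_eventually_lit_ge [OF assms(1)] by blast
  obtain m' where m': "first_difference (eventually_lit \<gamma>') x m'"
    using first_difference_exists up_ray_eventually_lit_ge [OF assms(2)] by blast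
  have "m = m'" using first_difference_unique [OF m m'] eq assms(4) by simp
  moreover have "k = l" using up_ray_turn_cong [OF assms(1,2)] eq assms(3) by simp
  ultimately show ?thesis
    using LIMSEQ_unique [OF busemann_tendsto [OF up_ray_ray [OF assms(1)]] up_ray_tendsto [OF assms(1) m]]
      LIMSEQ_unique [OF busemann_tendsto [OF up_ray_ray [OF assms(2)]] up_ray_tendsto [OF assms(2) m']]
    by simp
qed

text \<open>Besides being open, \<open>W\<close> is saturated under \<open>asymptotic\<close>, so
  that its image in the quotient is open.\<close>

lemma up_ray_neighbourhood:
  assumes up0: "up_ray k0 \<gamma>0" and "finite K"
  obtains W where "openin ray_topology W" "\<gamma>0 \<in> W"
    "\<And>\<gamma> \<gamma>'. \<gamma> \<in> W \<Longrightarrow> (\<gamma>, \<gamma>') \<in> asymptotic \<Longrightarrow> \<gamma>' \<in> W"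
    "\<And>\<gamma> k x. \<gamma> \<in> W \<Longrightarrow> up_ray k \<gamma> \<Longrightarrow> x \<in> K \<Longrightarrow> busemann \<gamma> x = busemann \<gamma>0 x"
proof -
  obtain N where N: "0 \<le> N" "\<And>x. x \<in> K \<Longrightarrow> height x \<le> N"
  proof
    show "0 \<le> Max (insert 0 (height ` K))" using \<open>finite K\<close> by simp
    show "height x \<le> Max (insert 0 (height ` K))" if "x \<in> K" for x using \<open>finite K\<close> that by simp
  qed
  \<comment> \<open>Rays that turn down above height \<open>N\<close> must be admitted with arbitrary lamps for the set to be
    open, since on their way back they may still toggle the lamps below \<open>N\<close>.\<close>
  define A where "A \<gamma> \<longleftrightarrow> (\<exists>k. up_ray k \<gamma>) \<and> (\<forall>i<N. eventually_lit \<gamma> i = eventually_lit \<gamma>0 i)" for \<gamma>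
  define B where "B \<gamma> \<longleftrightarrow> (\<exists>k. down_ray k \<gamma> \<and> int k > N)" for \<gamma>
  define W where "W = {\<gamma> \<in> based_rays. A \<gamma> \<or> B \<gamma>}"
  have no_both: False if "up_ray k \<gamma>" "down_ray l \<gamma>" for k l \<gamma>
    using up_ray_height [OF that(1), of "k + l + 1"] down_ray_height [OF that(2), of "k + l + 1"] by simp
  have A_nhd: "\<gamma>' \<in> W" if up: "up_ray k \<gamma>" and "A \<gamma>" and "\<gamma>' \<in> based_rays"
    and agree: "\<gamma>' (2 * k + nat N + 1) = \<gamma> (2 * k + nat N + 1)" for \<gamma> \<gamma>' k
  proof -
    \<comment> \<open>At time n the height is \<open>N + 1\<close>. A ray through the same point
      either climbs with its lamps below \<open>N\<close> settled, or belongs to \<open>B\<close>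
      because its peak is above \<open>N\<close>.\<close>
    define n where "n = 2 * k + nat N + 1"
    have h: "height (\<gamma>' n) = N + 1" using agree up_ray_height [OF up, of n] N(1) by (simp add: n_def)
    show ?thesis
      using \<open>\<gamma>' \<in> based_rays\<close>
    proof (cases rule: ray_cases)
      case (1 l)
      have "l \<le> n" using h up_ray_height [OF 1, of n] N(1) by linarith
      have "eventually_lit \<gamma>' i = eventually_lit \<gamma>0 i" if "i < N" for i
      proof -
        have "eventually_lit \<gamma>' i = (i |\<in>| lit (\<gamma>' n))"
          using up_ray_eventually_lit [OF 1 \<open>l \<le> n\<close>, of i] h that by simp
        also have "\<dots> = eventually_lit \<gamma> i"
          using up_ray_eventually_lit [OF up, of n i] agree h that by (simp add: n_def)
        finally show ?thesis using \<open>A \<gamma>\<close> that by (simp add: A_def)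
      qed
      then show ?thesis using 1 \<open>\<gamma>' \<in> based_rays\<close> by (auto simp: W_def A_def)
    next
      case (2 l)
      then have "int l > N" using h down_ray_height [OF 2, of n] by linarith
      then show ?thesis using 2 \<open>\<gamma>' \<in> based_rays\<close> by (auto simp: W_def B_def)
    qed
  qed
  have B_nhd: "\<gamma>' \<in> W" if down: "down_ray k \<gamma>" and "int k > N" and "\<gamma>' \<in> based_rays"
    and agree: "\<gamma>' k = \<gamma> k" "\<gamma>' (Suc k) = \<gamma> (Suc k)" for \<gamma> \<gamma>' k
  proof -
    \<comment> \<open>These two heights exhibit the peak, so every ray that shares them turns down
      at the same time k.\<close>
    have h: "height (\<gamma>' k) = int k" "height (\<gamma>' (Suc k)) = int k - 1"
      using agree down_ray_height [OF down] by simp_all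
    show ?thesis
      using \<open>\<gamma>' \<in> based_rays\<close>
    proof (cases rule: ray_cases)
      case (1 l)
      then show ?thesis
        using h up_ray_height [OF 1, of k] up_ray_height [OF 1, of "Suc k"] N(1) \<open>int k > N\<close> by simp
    next
      case (2 l)
      then have "k = l" using h down_ray_height [OF 2, of k] down_ray_height [OF 2, of "Suc k"] by simp
      then show ?thesis using 2 \<open>\<gamma>' \<in> based_rays\<close> \<open>int k > N\<close> by (auto simp: W_def B_def)
    qed
  qed
  show ?thesis
  proof (rule that)
    have "\<exists>n. \<forall>\<gamma>'\<in>based_rays. (\<forall>j\<le>n. \<gamma>' j = \<gamma> j) \<longrightarrow> \<gamma>' \<in> W" if "\<gamma> \<in> W" for \<gamma>
    proof (cases "A \<gamma>")
      case True
      then obtain k where "up_ray k \<gamma>" by (auto simp: A_def)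
      with A_nhd True show ?thesis by blast
    next
      case False
      then obtain k where k: "down_ray k \<gamma>" "int k > N"
        using \<open>\<gamma> \<in> W\<close> unfolding W_def B_def by blast
      show ?thesis by (rule exI [of _ "Suc k"]) (use B_nhd [OF k] in auto)
    qed
    then show "openin ray_topology W"
      by (auto simp: openin_ray_topology W_def)
    show "\<gamma>0 \<in> W" using up0 up_ray_ray [OF up0] by (auto simp: W_def A_def)
    show "\<gamma>' \<in> W" if "\<gamma> \<in> W" and asym: "(\<gamma>, \<gamma>') \<in> asymptotic" for \<gamma> \<gamma>'
    proof -
      have "A \<gamma>'" if "A \<gamma>"
        using that up_ray_asymptotic [OF _ asym] by (auto simp: A_def)
      moreover have "B \<gamma>'" if "B \<gamma>"
        using that up_ray_asymptotic(1) [OF _ asymptotic_reflect [OF asym]] by (auto simp: B_def)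
      moreover have "\<gamma>' \<in> based_rays" using asym by (simp add: asymptotic_def)
      ultimately show ?thesis using \<open>\<gamma> \<in> W\<close> by (auto simp: W_def)
    qed
    show "busemann \<gamma> x = busemann \<gamma>0 x" if "\<gamma> \<in> W" "up_ray k \<gamma>" "x \<in> K" for \<gamma> k x
    proof -
      have "A \<gamma>" using that no_both by (auto simp: W_def B_def)
      then show ?thesis
        using up_ray_busemann_cong [OF that(2) up0 N(1) N(2) [OF that(3)]] by (simp add: A_def)
    qed
  qed
qed

lemma openin_ray_topology_reflect:
  assumes "openin ray_topology W"
  shows "openin ray_topology {\<gamma>. reflect \<circ> \<gamma> \<in> W}"
  unfolding openin_ray_topology
proof (intro conjI ballI)
  show "{\<gamma>. reflect \<circ> \<gamma> \<in> W} \<subseteq> based_rays"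
    using assms reflect_based_rays unfolding openin_ray_topology by blast
  fix \<gamma> assume "\<gamma> \<in> {\<gamma>. reflect \<circ> \<gamma> \<in> W}"
  then obtain n where n: "\<forall>\<gamma>'\<in>based_rays. (\<forall>j\<le>n. \<gamma>' j = (reflect \<circ> \<gamma>) j) \<longrightarrow> \<gamma>' \<in> W"
    using assms unfolding openin_ray_topology by blast
  show "\<exists>n. \<forall>\<gamma>'\<in>based_rays. (\<forall>j\<le>n. \<gamma>' j = \<gamma> j) \<longrightarrow> \<gamma>' \<in> {\<gamma>. reflect \<circ> \<gamma> \<in> W}"
    using n [rule_format, of "reflect \<circ> _"] by (auto intro!: exI [of _ n])
qed

lemma down_ray_neighbourhood:
  assumes "down_ray k0 \<gamma>0" and "finite K"
  obtains W where "openin ray_topology W" "\<gamma>0 \<in> W"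
    "\<And>\<gamma> \<gamma>'. \<gamma> \<in> W \<Longrightarrow> (\<gamma>, \<gamma>') \<in> asymptotic \<Longrightarrow> \<gamma>' \<in> W"
    "\<And>\<gamma> k x. \<gamma> \<in> W \<Longrightarrow> down_ray k \<gamma> \<Longrightarrow> x \<in> K \<Longrightarrow> busemann \<gamma> x = busemann \<gamma>0 x"
proof -
  have "finite (reflect ` K)" using assms(2) by simp
  then obtain W where W: "openin ray_topology W" "reflect \<circ> \<gamma>0 \<in> W"
    "\<And>\<gamma> \<gamma>'. \<gamma> \<in> W \<Longrightarrow> (\<gamma>, \<gamma>') \<in> asymptotic \<Longrightarrow> \<gamma>' \<in> W"
    "\<And>\<gamma> k x. \<gamma> \<in> W \<Longrightarrow> up_ray k \<gamma> \<Longrightarrow> x \<in> reflect ` K \<Longrightarrow> busemann \<gamma> x = busemann (reflect \<circ> \<gamma>0) x"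
    by (rule up_ray_neighbourhood [OF assms(1)]) blast
  show ?thesis
  proof (rule that [OF openin_ray_topology_reflect [OF W(1)]])
    show "busemann \<gamma> x = busemann \<gamma>0 x"
      if "\<gamma> \<in> {\<gamma>. reflect \<circ> \<gamma> \<in> W}" "down_ray k \<gamma>" "x \<in> K" for \<gamma> k x
      using W(4) [of "reflect \<circ> \<gamma>" k "reflect x"] that by (simp add: busemann_reflect)
  qed (use W asymptotic_reflect in auto)
qed

section \<open>The Busemann map on asymptotic classes\<close>

definition busemann_map :: "(nat \<Rightarrow> lampstand) set \<Rightarrow> lampstand \<Rightarrow> real" where
  "busemann_map c = busemann (SOME \<gamma>. \<gamma> \<in> c)"

lemma busemann_map_class:
  assumes "\<gamma> \<in> based_rays"
  shows "busemann_map (asymptotic `` {\<gamma>}) = busemann \<gamma>"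
proof -
  have "\<gamma> \<in> asymptotic `` {\<gamma>}" using equiv_class_self [OF equiv_asymptotic assms] .
  then have "(SOME \<gamma>'. \<gamma>' \<in> asymptotic `` {\<gamma>}) \<in> asymptotic `` {\<gamma>}" by (rule someI [where P = "\<lambda>\<gamma>'. \<gamma>' \<in> asymptotic `` {\<gamma>}"])
  then show ?thesis
    unfolding busemann_map_def using busemann_cong by (metis Image_singleton_iff)
qed

lemma busemann_map_image: "busemann_map ` visual_boundary \<subseteq> horofunction_boundary"
  by (auto simp: visual_boundary_def quotient_def busemann_map_class busemann_horofunction)

lemma inj_on_busemann_map: "inj_on busemann_map visual_boundary"
proof (rule inj_onI)
  fix c c' assume "c \<in> visual_boundary" "c' \<in> visual_boundary" and eq: "busemann_map c = busemann_map c'"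
  then obtain \<gamma> \<gamma>' where *: "\<gamma> \<in> based_rays" "c = asymptotic `` {\<gamma>}" "\<gamma>' \<in> based_rays" "c' = asymptotic `` {\<gamma>'}"
    by (auto simp: visual_boundary_def quotient_def)
  then have "(\<gamma>, \<gamma>') \<in> asymptotic" using eq by (intro busemann_inj) (simp_all add: busemann_map_class)
  then show "c = c'" using * equiv_class_eq [OF equiv_asymptotic] by simp
qed

text \<open>\<open>P\<close> stands for the direction, so both halves of the boundary are treated at
  once. Local constancy on finite sets suffices because basic neighbourhoods of a function constrain
  finitely many values.\<close>

lemma continuous_map_busemann_map:
  assumes nhd: "\<And>\<gamma> K. P \<gamma> \<Longrightarrow> \<gamma> \<in> based_rays \<Longrightarrow> finite K \<Longrightarrow>
      \<exists>W. openin ray_topology W \<and> \<gamma> \<in> W \<and>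
        (\<forall>\<gamma>' \<gamma>''. \<gamma>' \<in> W \<longrightarrow> (\<gamma>', \<gamma>'') \<in> asymptotic \<longrightarrow> \<gamma>'' \<in> W) \<and>
        (\<forall>\<gamma>'\<in>W. P \<gamma>' \<longrightarrow> (\<forall>x\<in>K. busemann \<gamma>' x = busemann \<gamma> x))"
    and C: "C = {asymptotic `` {\<gamma>} | \<gamma>. \<gamma> \<in> based_rays \<and> P \<gamma>}"
  shows "continuous_map (subtopology visual_topology C) horofunction_topology busemann_map"
proof -
  have sub: "C \<subseteq> visual_boundary" by (auto simp: C visual_boundary_def quotientI)
  have "openin (subtopology visual_topology C) {c \<in> C. busemann_map c \<in> U}"
    if "openin horofunction_topology U" for U
  proof (subst openin_subopen, rule ballI)
    fix c assume c: "c \<in> {c \<in> C. busemann_map c \<in> U}"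
    then obtain \<gamma> where \<gamma>: "\<gamma> \<in> based_rays" "P \<gamma>" "c = asymptotic `` {\<gamma>}" by (auto simp: C)
    then have "busemann \<gamma> \<in> U" using c by (simp add: busemann_map_class)
    moreover obtain V where V: "openin (ucc_topology dist) V" "U = V \<inter> horofunction_boundary"
      using \<open>openin horofunction_topology U\<close> by (auto simp: horofunction_topology_def openin_subtopology)
    ultimately obtain K e where K: "finite K" "e > 0" "{g. \<forall>x\<in>K. dist (busemann \<gamma> x) (g x) < e} \<subseteq> V"
      unfolding openin_ucc_topology by blast
    obtain W where W: "openin ray_topology W" "\<gamma> \<in> W"
      "\<And>\<gamma>' \<gamma>''. \<gamma>' \<in> W \<Longrightarrow> (\<gamma>', \<gamma>'') \<in> asymptotic \<Longrightarrow> \<gamma>'' \<in> W"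
      "\<And>\<gamma>' x. \<gamma>' \<in> W \<Longrightarrow> P \<gamma>' \<Longrightarrow> x \<in> K \<Longrightarrow> busemann \<gamma>' x = busemann \<gamma> x"
      using nhd [OF \<gamma>(2,1) K(1)] by blast
    have W_rays: "W \<subseteq> based_rays" using W(1) by (simp add: openin_ray_topology)
    define T where "T = (\<lambda>\<gamma>. asymptotic `` {\<gamma>}) ` W"
    \<comment> \<open>Saturation enters here: the preimage of \<open>T\<close> under the quotient
      map is \<open>W\<close> itself.\<close>
    have class_T: "\<gamma>' \<in> W" if "\<gamma>' \<in> based_rays" "asymptotic `` {\<gamma>'} \<in> T" for \<gamma>'
    proof -
      obtain \<gamma>'' where "\<gamma>'' \<in> W" "asymptotic `` {\<gamma>'} = asymptotic `` {\<gamma>''}"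
        using \<open>asymptotic `` {\<gamma>'} \<in> T\<close> by (auto simp: T_def)
      then show ?thesis
        using W(3) [of \<gamma>'' \<gamma>'] eq_equiv_class [OF _ equiv_asymptotic] \<open>\<gamma>' \<in> based_rays\<close> by metis
    qed
    have "{\<gamma> \<in> based_rays. asymptotic `` {\<gamma>} \<in> T} = W"
      using class_T W_rays by (auto simp: T_def)
    then have "openin visual_topology T"
      using W(1) W_rays by (auto simp: openin_visual_topology T_def visual_boundary_def quotientI)
    moreover have "T \<inter> C \<subseteq> {c \<in> C. busemann_map c \<in> U}"
    proof
      fix c' assume c': "c' \<in> T \<inter> C"
      then obtain \<gamma>' where \<gamma>': "\<gamma>' \<in> based_rays" "P \<gamma>'" "c' = asymptotic `` {\<gamma>'}" by (auto simp: C)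
      then have "\<gamma>' \<in> W" using c' class_T by simp
      then have "busemann \<gamma>' \<in> V" using W(4) \<gamma>'(2) K(2,3) by auto
      then show "c' \<in> {c \<in> C. busemann_map c \<in> U}"
        using c' \<gamma>' V(2) by (simp add: busemann_map_class busemann_horofunction)
    qed
    moreover have "c \<in> T \<inter> C" using c \<gamma>(3) W(2) by (simp add: T_def)
    ultimately show "\<exists>T. openin (subtopology visual_topology C) T \<and> c \<in> T \<and> T \<subseteq> {c \<in> C. busemann_map c \<in> U}"
      by (intro exI [of _ "T \<inter> C"]) (auto simp: openin_subtopology)
  qed
  moreover have "topspace (subtopology visual_topology C) = C" using sub by auto
  moreover have "busemann_map \<in> C \<rightarrow> horofunction_boundary"
    using busemann_map_image sub by blast
  ultimately show ?thesis
    unfolding continuous_map_def by simp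
qed

section \<open>The two halves of the boundary as classes of upward and downward rays\<close>

lemma up_ray_iff_at_top:
  assumes "\<gamma> \<in> based_rays"
  shows "filterlim (\<lambda>n. height (\<gamma> n)) at_top sequentially \<longleftrightarrow> (\<exists>k. up_ray k \<gamma>)"
proof
  assume lim: "filterlim (\<lambda>n. height (\<gamma> n)) at_top sequentially"
  show "\<exists>k. up_ray k \<gamma>"
    using assms
  proof (cases rule: ray_cases)
    case (2 k)
    from lim have "\<forall>\<^sub>F n in sequentially. int k + 1 \<le> height (\<gamma> n)" by (simp add: filterlim_at_top)
    then have "\<forall>\<^sub>F n in sequentially. False"
      by eventually_elim (simp add: down_ray_height [OF 2])
    then show ?thesis by simp
  qed blast
next
  assume "\<exists>k. up_ray k \<gamma>"
  then obtain k where k: "up_ray k \<gamma>" ..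
  show "filterlim (\<lambda>n. height (\<gamma> n)) at_top sequentially"
    unfolding filterlim_at_top
  proof
    fix Z
    show "\<forall>\<^sub>F n in sequentially. Z \<le> height (\<gamma> n)"
      using eventually_ge_at_top [of "nat Z + 2 * k"]
      by eventually_elim (simp add: up_ray_height [OF k])
  qed
qed

lemma down_ray_iff_at_bot:
  assumes "\<gamma> \<in> based_rays"
  shows "filterlim (\<lambda>n. height (\<gamma> n)) at_bot sequentially \<longleftrightarrow> (\<exists>k. down_ray k \<gamma>)"
proof -
  have "(\<forall>Z. Q (- Z)) \<longleftrightarrow> (\<forall>Z. Q Z)" for Q :: "int \<Rightarrow> bool"
    by (metis minus_minus)
  from this [of "\<lambda>Z. \<forall>\<^sub>F n in sequentially. height (\<gamma> n) \<le> Z"]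
  have "filterlim (\<lambda>n. height (\<gamma> n)) at_bot sequentially \<longleftrightarrow>
      filterlim (\<lambda>n. height ((reflect \<circ> \<gamma>) n)) at_top sequentially"
    by (simp add: filterlim_at_top filterlim_at_bot le_minus_iff)
  then show ?thesis using up_ray_iff_at_top [of "reflect \<circ> \<gamma>"] assms by simp
qed

lemma continuous_map_busemann_map_plus:
  "continuous_map (subtopology visual_topology visual_boundary_plus) horofunction_topology busemann_map"
proof (rule continuous_map_busemann_map [where P = "\<lambda>\<gamma>. \<exists>k. up_ray k \<gamma>"])
  show "visual_boundary_plus = {asymptotic `` {\<gamma>} |\<gamma>. \<gamma> \<in> based_rays \<and> (\<exists>k. up_ray k \<gamma>)}"
    unfolding visual_boundary_plus_def using up_ray_iff_at_top by blast
next
  fix \<gamma> K assume "\<exists>k. up_ray k \<gamma>" "finite (K :: lampstand set)"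
  then obtain k where "up_ray k \<gamma>" by blast
  from up_ray_neighbourhood [OF this \<open>finite K\<close>]
  show "\<exists>W. openin ray_topology W \<and> \<gamma> \<in> W \<and>
        (\<forall>\<gamma>' \<gamma>''. \<gamma>' \<in> W \<longrightarrow> (\<gamma>', \<gamma>'') \<in> asymptotic \<longrightarrow> \<gamma>'' \<in> W) \<and>
        (\<forall>\<gamma>'\<in>W. (\<exists>k. up_ray k \<gamma>') \<longrightarrow> (\<forall>x\<in>K. busemann \<gamma>' x = busemann \<gamma> x))"
    by metis
qed

lemma continuous_map_busemann_map_minus:
  "continuous_map (subtopology visual_topology visual_boundary_minus) horofunction_topology busemann_map"
proof (rule continuous_map_busemann_map [where P = "\<lambda>\<gamma>. \<exists>k. down_ray k \<gamma>"])
  show "visual_boundary_minus = {asymptotic `` {\<gamma>} |\<gamma>. \<gamma> \<in> based_rays \<and> (\<exists>k. down_ray k \<gamma>)}"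
    unfolding visual_boundary_minus_def using down_ray_iff_at_bot by blast
next
  fix \<gamma> K assume "\<exists>k. down_ray k \<gamma>" "finite (K :: lampstand set)"
  then obtain k where "down_ray k \<gamma>" by blast
  from down_ray_neighbourhood [OF this \<open>finite K\<close>]
  show "\<exists>W. openin ray_topology W \<and> \<gamma> \<in> W \<and>
        (\<forall>\<gamma>' \<gamma>''. \<gamma>' \<in> W \<longrightarrow> (\<gamma>', \<gamma>'') \<in> asymptotic \<longrightarrow> \<gamma>'' \<in> W) \<and>
        (\<forall>\<gamma>'\<in>W. (\<exists>k. down_ray k \<gamma>') \<longrightarrow> (\<forall>x\<in>K. busemann \<gamma>' x = busemann \<gamma> x))"
    by metis
qed

section \<open>Discontinuity\<close>

lemma based_raysI:
  assumes "\<gamma> 0 = Lampstand {||} 0" "\<And>m n. m \<le> n \<Longrightarrow> d2 (\<gamma> m) (\<gamma> n) = real n - real m"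
  shows "\<gamma> \<in> based_rays"
proof -
  have "d2 (\<gamma> m) (\<gamma> n) = \<bar>real m - real n\<bar>" for m n
    using assms(2) [of m n] assms(2) [of n m] d2_commute [of "\<gamma> m" "\<gamma> n"] by (cases "m \<le> n") auto
  then show ?thesis using assms(1) by (simp add: based_rays_def)
qed

definition climbing_ray :: "nat \<Rightarrow> lampstand" where
  "climbing_ray n = Lampstand {||} (int n)"

definition returning_ray :: "nat \<Rightarrow> nat \<Rightarrow> lampstand" where
  "returning_ray k n =
     (if n \<le> k then Lampstand {||} (int n) else Lampstand {|int k - 1|} (2 * int k - int n))"

lemma climbing_ray: "climbing_ray \<in> based_rays"
proof (rule based_raysI)
  fix m n :: nat assume "m \<le> n"
  then have "spans (int m) (int n) (climbing_ray m) (climbing_ray n)"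
    by (simp add: spans_def climbing_ray_def)
  from d2_eq [OF this] \<open>m \<le> n\<close> show "d2 (climbing_ray m) (climbing_ray n) = real n - real m"
    by (simp add: climbing_ray_def)
qed (simp add: climbing_ray_def)

lemma returning_ray: "returning_ray k \<in> based_rays"
proof (rule based_raysI)
  fix m n :: nat assume "m \<le> n"
  consider "n \<le> k" | "m > k" | "m \<le> k" "k < n" by linarith
  then show "d2 (returning_ray k m) (returning_ray k n) = real n - real m"
  proof cases
    case 1
    then have "spans (int m) (int n) (returning_ray k m) (returning_ray k n)"
      using \<open>m \<le> n\<close> by (simp add: spans_def returning_ray_def)
    from d2_eq [OF this] show ?thesis using 1 \<open>m \<le> n\<close> by (simp add: returning_ray_def)
  next
    case 2
    then have "spans (2 * int k - int n) (2 * int k - int m) (returning_ray k m) (returning_ray k n)"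
      using \<open>m \<le> n\<close> by (simp add: spans_def returning_ray_def)
    from d2_eq [OF this] show ?thesis using 2 \<open>m \<le> n\<close> by (simp add: returning_ray_def)
  next
    \<comment> \<open>The points lie on opposite sides of the peak and differ in lamp k - 1, which
      forces the upper end k and makes the ray geodesic.\<close>
    case 3
    then have "spans (min (int m) (2 * int k - int n)) (int k) (returning_ray k m) (returning_ray k n)"
      by (auto simp: spans_def returning_ray_def)
    from d2_eq [OF this] show ?thesis
      using 3 by (cases "int m \<le> 2 * int k - int n") (simp_all add: returning_ray_def min_def)
  qed
qed (simp add: returning_ray_def)

text \<open>From height n the path descends to 0, lights lamp 0 and ends at height 1, in n + 1
  steps.\<close>

lemma busemann_climbing_ray: "busemann climbing_ray (Lampstand {|0|} 1) = 1"
proof (rule LIMSEQ_unique [OF busemann_tendsto [OF climbing_ray]], rule tendsto_eventually)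
  show "\<forall>\<^sub>F n in sequentially. d2 (climbing_ray n) (Lampstand {|0|} 1) - real n = 1"
    using eventually_ge_at_top [of 1]
  proof eventually_elim
    case (elim n)
    then have "spans 0 (int n) (climbing_ray n) (Lampstand {|0|} 1)"
      by (auto simp: spans_def climbing_ray_def)
    from d2_eq [OF this] elim show ?case by (simp add: climbing_ray_def)
  qed
qed

text \<open>From far below, the path climbs to k to put out lamp k - 1 and returns to height 1; lamp
  0 is lit in passing, in n - 1 steps altogether.\<close>

lemma busemann_returning_ray:
  assumes "k \<ge> 2"
  shows "busemann (returning_ray k) (Lampstand {|0|} 1) = - 1"
proof (rule LIMSEQ_unique [OF busemann_tendsto [OF returning_ray]], rule tendsto_eventually)
  show "\<forall>\<^sub>F n in sequentially. d2 (returning_ray k n) (Lampstand {|0|} 1) - real n = - 1"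
    using eventually_ge_at_top [of "2 * k"]
  proof eventually_elim
    case (elim n)
    then have "spans (2 * int k - int n) (int k) (returning_ray k n) (Lampstand {|0|} 1)"
      using assms by (auto simp: spans_def returning_ray_def)
    from d2_eq [OF this] elim assms show ?case by (simp add: returning_ray_def)
  qed
qed

text \<open>Composition with the quotient map moves the question to rays. Every initial segment of
  \<open>climbing_ray\<close> extends to a returning ray, whose Busemann function has the opposite
  sign at x.\<close>

lemma not_continuous_busemann_map:
  "\<not> continuous_map visual_topology horofunction_topology busemann_map"
proof
  define x where "x = Lampstand {|0|} 1"
  assume "continuous_map visual_topology horofunction_topology busemann_map"
  then have "continuous_map ray_topology horofunction_topology (busemann_map \<circ> (\<lambda>\<gamma>. asymptotic `` {\<gamma>}))"
    by (rule continuous_map_compose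
      [OF quotient_imp_continuous_map [OF quotient_map_visual_topology]])
  moreover have "openin (ucc_topology dist) {f :: lampstand \<Rightarrow> real. f x > 0}"
    unfolding openin_ucc_topology
  proof
    fix f :: "lampstand \<Rightarrow> real" assume "f \<in> {f. f x > 0}"
    then show "\<exists>K e. finite K \<and> e > 0 \<and> {g. \<forall>x\<in>K. dist (f x) (g x) < e} \<subseteq> {f. f x > 0}"
      by (intro exI [of _ "{x}"] exI [of _ "f x"]) (auto simp: dist_real_def)
  qed
  then have "openin horofunction_topology ({f. f x > 0} \<inter> horofunction_boundary)"
    by (auto simp: horofunction_topology_def openin_subtopology)
  ultimately have "openin ray_topology {\<gamma> \<in> topspace ray_topology.
      (busemann_map \<circ> (\<lambda>\<gamma>. asymptotic `` {\<gamma>})) \<gamma> \<in> {f. f x > 0} \<inter> horofunction_boundary}"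
    by (rule openin_continuous_map_preimage)
  also have "{\<gamma> \<in> topspace ray_topology.
      (busemann_map \<circ> (\<lambda>\<gamma>. asymptotic `` {\<gamma>})) \<gamma> \<in> {f. f x > 0} \<inter> horofunction_boundary} =
      {\<gamma> \<in> based_rays. busemann \<gamma> x > 0}"
    by (auto simp: busemann_map_class busemann_horofunction)
  finally have "openin ray_topology {\<gamma> \<in> based_rays. busemann \<gamma> x > 0}" .
  moreover have "climbing_ray \<in> {\<gamma> \<in> based_rays. busemann \<gamma> x > 0}"
    by (simp add: climbing_ray busemann_climbing_ray x_def)
  ultimately obtain n where
    n: "\<forall>\<gamma>\<in>based_rays. (\<forall>j\<le>n. \<gamma> j = climbing_ray j) \<longrightarrow> \<gamma> \<in> {\<gamma> \<in> based_rays. busemann \<gamma> x > 0}"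
    unfolding openin_ray_topology by blast
  \<comment> \<open>The peak n + 2 lies beyond the prescribed segment and meets the bound in
    \<open>busemann_returning_ray\<close>.\<close>
  have "\<forall>j\<le>n. returning_ray (n + 2) j = climbing_ray j"
    by (simp add: returning_ray_def climbing_ray_def)
  then have "busemann (returning_ray (n + 2)) x > 0"
    using n returning_ray by blast
  then show False by (simp add: busemann_returning_ray x_def)
qed

theorem theoremA:
  shows "\<exists>\<Phi> :: (nat \<Rightarrow> lampstand) set \<Rightarrow> (lampstand \<Rightarrow> real).
    (\<forall>\<gamma>\<in>based_rays. \<forall>x.
       (\<lambda>n. d2 (\<gamma> n) x - d2 (\<gamma> n) \<one>\<^bsub>L2\<^esub>) \<longlonglongrightarrow> \<Phi> (asymptotic `` {\<gamma>}) x) \<and>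
    \<Phi> ` visual_boundary \<subseteq> horofunction_boundary \<and>
    inj_on \<Phi> visual_boundary \<and>
    \<not> continuous_map visual_topology horofunction_topology \<Phi> \<and>
    continuous_map (subtopology visual_topology visual_boundary_plus) horofunction_topology \<Phi> \<and>
    continuous_map (subtopology visual_topology visual_boundary_minus) horofunction_topology \<Phi>"
proof (intro exI [of _ busemann_map] conjI ballI allI)
  fix \<gamma> x assume "\<gamma> \<in> based_rays"
  then show "(\<lambda>n. d2 (\<gamma> n) x - d2 (\<gamma> n) \<one>\<^bsub>L2\<^esub>) \<longlonglongrightarrow> busemann_map (asymptotic `` {\<gamma>}) x"
    by (simp add: busemann_map_class ray_dist_0 busemann_tendsto)
qed (rule busemann_map_image inj_on_busemann_map not_continuous_busemann_map
    continuous_map_busemann_map_plus continuous_map_busemann_map_minus)+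

end
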